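(* Let $m_1,m_2\in\mathbb{N}$, $T>0$, and let $\varphi$ and $\widetilde\varphi$ be the Weyl–Titchmarsh functions on $[0,\infty)$ of two Dirac-type systems with potentials $v,\widetilde v\in\big[C^1([0,\infty))\big]^{m_1\times m_2}$, respectively. Suppose that for some $c\in\mathbb{R}$, along the ray $\{z:\Re z=c\,\Im z,\ \Im z>0\}$, for each $\varepsilon>0$ one has $\|\varphi(z)-\widetilde\varphi(z)\|=O\big(e^{2i(T-\varepsilon)z}\big)$ as $|z|\to\infty$ (for some matrix norm). Then $v(x)=\widetilde v(x)$ for all $x\in[0,T]$.
   Context: Dirac-type system with potential $v$: $y'(x,z)=i(zJ+JV(x))y(x,z)$, $x\ge0$, $m=m_1+m_2$, $J=\begin{bmatrix}I_{m_1}&0\\0&-I_{m_2}\end{bmatrix}$, $V=\begin{bmatrix}0_{m_1}&v\\ v^*&0_{m_2}\end{bmatrix}$. With $u_0(x,z)$ the fundamental solution satisfying $u_0(0,z)=I_m$, the Weyl–Titchmarsh function $\varphi$ is the unique $m_2\times m_1$ matrix function holomorphic in $\mathbb{C}_+$ such that $u_0(\cdot,z)\begin{bmatrix}I_{m_1}\\ \varphi(z)\end{bmatrix}$ has entries in $L^2((0,\infty))$. *)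

theory Defs
  imports "HOL-Analysis.Analysis" "HOL-Complex_Analysis.Complex_Analysis"
          "HOL-Library.Landau_Symbols"
begin

text \<open>Matrices are type-indexed: an m1 x m2 matrix is complex^'b^'a with
 CARD('a) = m1, CARD('b) = m2; the full m x m system lives on the index type
 'a + 'b (first m1 coordinates Inl, last m2 coordinates Inr).\<close>

definition dirac_J :: "complex^('a::finite + 'b::finite)^('a + 'b)" where
  "dirac_J = (\<chi> i j. if i = j then (case i of Inl _ \<Rightarrow> 1 | Inr _ \<Rightarrow> -1) else 0)"

definition dirac_V :: "complex^'b^'a \<Rightarrow> complex^('a::finite + 'b::finite)^('a + 'b)" where
  "dirac_V w = (\<chi> i j. case (i, j) of
       (Inl a, Inr b) \<Rightarrow> w $ a $ b
     | (Inr b, Inl a) \<Rightarrow> cnj (w $ a $ b)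
     | _ \<Rightarrow> 0)"

definition dirac_coeff :: "(real \<Rightarrow> complex^'b^'a) \<Rightarrow> complex \<Rightarrow> real
     \<Rightarrow> complex^('a::finite + 'b::finite)^('a + 'b)" where
  "dirac_coeff v z x = (\<chi> i j. \<i> * (z * dirac_J $ i $ j + (dirac_J ** dirac_V (v x)) $ i $ j))"

definition C1_on_halfline :: "(real \<Rightarrow> 'c::real_normed_vector) \<Rightarrow> bool" where
  "C1_on_halfline v \<longleftrightarrow> (\<exists>v'. (\<forall>x\<ge>0. (v has_vector_derivative v' x) (at x within {0..}))
                            \<and> continuous_on {0..} v')"

definition fundamental_solution ::
  "(real \<Rightarrow> complex^'b^'a) \<Rightarrow> complex \<Rightarrow> (real \<Rightarrow> complex^('a::finite + 'b::finite)^('a + 'b)) \<Rightarrow> bool" where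
  "fundamental_solution v z U \<longleftrightarrow> U 0 = mat 1 \<and>
     (\<forall>x\<ge>0. (U has_vector_derivative (dirac_coeff v z x ** U x)) (at x within {0..}))"

definition block_col :: "complex^'a^'b \<Rightarrow> complex^'a^('a::finite + 'b::finite)" where
  "block_col P = (\<chi> i j. case i of Inl a \<Rightarrow> (if a = j then 1 else 0) | Inr b \<Rightarrow> P $ b $ j)"

definition square_integrable_halfline :: "(real \<Rightarrow> complex) \<Rightarrow> bool" where
  "square_integrable_halfline g \<longleftrightarrow>
     set_borel_measurable lborel {0<..} g \<and> set_integrable lborel {0<..} (\<lambda>x. (cmod (g x))\<^sup>2)"

text \<open>phi is the Weyl-Titchmarsh function of the system with potential v:
 holomorphic in C_+, and u_0(.,z)[I; phi(z)] has L^2(0,\<infinity>) entries for every z in C_+.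
 (Such phi is unique, so this characterises it.)\<close>
definition weyl_function :: "(real \<Rightarrow> complex^'b^'a) \<Rightarrow> (complex \<Rightarrow> complex^'a^'b) \<Rightarrow> bool" where
  "weyl_function v \<phi> \<longleftrightarrow>
     (\<forall>b a. (\<lambda>z. \<phi> z $ b $ a) holomorphic_on {z. Im z > 0}) \<and>
     (\<forall>z. Im z > 0 \<longrightarrow> (\<exists>U::real \<Rightarrow> complex^('a::finite + 'b::finite)^('a + 'b).
        fundamental_solution v z U \<and>
        (\<forall>i j. square_integrable_halfline (\<lambda>x. (U x ** block_col (\<phi> z)) $ i $ j))))"

definition upper_ray :: "real \<Rightarrow> complex set" where
  "upper_ray c = {z. Re z = c * Im z \<and> Im z > 0}"

end

theory Submission
  imports Defs "HOL-Real_Asymp.Real_Asymp"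
begin

text \<open>Let u, u' be the fundamental solutions belonging to v, w. For fixed x < T the matrix
  M(z) = u'(x,z) u(x,z)^{-1} is entire in z, of exponential type. It is bounded on the real axis,
  where the systems are unitary up to the bounded potential term. It is also bounded on the
  given ray: splitting u(x,z)^{-1} e_j along the Weyl plane of v, the Weyl solutions decay like
  exp(-x Im z), the complementary ones grow at most like exp(x Im z), and the error from replacing
  the Weyl plane of v by that of w is O(exp(2x Im z)) times phi - psi, hence O(1).
  Phragmen-Lindelof in the two sectors between ray and real axis bounds M in the upper half-plane;
  the symmetry u(x,z)^{-1} = J u(x,conj z)^* J transfers this to the lower one, and Liouville makes M
  independent of z. Comparing coefficients of z in the differential equation for M gives
  M = 1 and then v = w.\<close>

text \<open>The delicate point is the bound on the ray, since the columns of u(x,z)^{-1} themselves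
  may grow like exp(x Im z). Split such a column q as (q1, \<phi> q1) + (0, r). The first term may
  be large but, up to the correction by \<phi> - \<psi>, a decaying solution of the other system
  continues it. The second is continued by a growing solution, so r itself must be of size exp(-x Im
  z). The reason is that r = (-\<phi>, I) q, and the formula for u(x,z)^{-1} turns each entry of r,
  up to sign and conjugation, into a component of a solution at conj z that starts J-orthogonally to
  the Weyl plane; such solutions decay as well. The underlying inequality |f2| <= |f1| for Weyl
  solutions comes from the monotone energy |f1|^2 - |f2|^2, so no asymptotic expansion of \<phi>
  enters. The ray also has a geometric role: Phragmen-Lindelof tolerates exponential type in sectors
  of opening below pi but not in a whole half-plane, as exp(-iz) shows.\<close>

unbundle no Formal_Power_Series.fps_syntax

section \<open>Linear systems depending on a complex parameter\<close>

lemma cmod_sum_mult_le: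
  fixes x y :: "complex^'n::finite"
  shows "cmod (\<Sum>i\<in>UNIV. x $ i * y $ i) \<le> norm x * norm y"
proof -
  have "cmod (\<Sum>i\<in>UNIV. x $ i * y $ i) \<le> (\<Sum>i\<in>UNIV. \<bar>cmod (x $ i)\<bar> * \<bar>cmod (y $ i)\<bar>)"
    by (rule order_trans[OF norm_sum]) (simp add: norm_mult)
  also have "\<dots> \<le> norm x * norm y"
    unfolding norm_vec_def by (rule L2_set_mult_ineq)
  finally show ?thesis .
qed

lemma norm_matrix_vector_mult_le:
  fixes A :: "complex^'n::finite^'m::finite"
  shows "norm (A *v x) \<le> norm A * norm x"
proof -
  have "norm (A *v x) \<le> L2_set (\<lambda>i. norm (A $ i) * norm x) UNIV"
    unfolding norm_vec_def[of "A *v x"]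
    by (rule L2_set_mono) (auto simp: matrix_vector_mult_def cmod_sum_mult_le)
  also have "\<dots> = norm A * norm x"
    by (simp add: norm_vec_def[of A] L2_set_left_distrib)
  finally show ?thesis .
qed

lemma bounded_bilinear_matrix_vector_mult:
  "bounded_bilinear ((*v) :: complex^'n::finite^'m::finite \<Rightarrow> _)"
proof
  show "\<exists>K. \<forall>(a::complex^'n^'m) b. norm (a *v b) \<le> norm a * norm b * K"
    by (rule exI[of _ 1]) (simp add: norm_matrix_vector_mult_le)
qed (auto simp: vec_eq_iff matrix_vector_mult_def sum.distrib algebra_simps scaleR_sum_right)

lemma norm_vector_scalar_mult: "norm (z *s (x::complex^'n::finite)) = cmod z * norm x"
  by (simp add: norm_vec_def norm_mult L2_set_right_distrib)

text \<open>The normed space structure of \<open>complex^'n\<close> is over the reals. Complex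
  scalars act through \<open>*s\<close>, which obtains its continuity and derivative rules from
  here.\<close>

lemma bounded_bilinear_vector_scalar_mult:
  "bounded_bilinear ((*s) :: complex \<Rightarrow> complex^'n::finite \<Rightarrow> _)"
proof
  show "\<exists>K. \<forall>a (b::complex^'n). norm (a *s b) \<le> norm a * norm b * K"
    by (rule exI[of _ 1]) (simp add: norm_vector_scalar_mult)
qed (auto simp: vec_eq_iff algebra_simps)

lemmas vec_mult_continuous_intros [continuous_intros] =
  bounded_bilinear.continuous_on[OF bounded_bilinear_matrix_vector_mult]
  bounded_bilinear.continuous_on[OF bounded_bilinear_vector_scalar_mult]

text \<open>The Picard iterates are polynomials in z with coefficients continuous in x; this class records
  that, so their holomorphy needs no differentiation under the integral sign.\<close>

inductive poly_family :: "(complex \<Rightarrow> real \<Rightarrow> complex^'n::finite) \<Rightarrow> bool" where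
  monom: "continuous_on {0..} c \<Longrightarrow> poly_family (\<lambda>z x. z ^ e *s c x)"
| add: "poly_family F \<Longrightarrow> poly_family G \<Longrightarrow> poly_family (\<lambda>z x. F z x + G z x)"

lemma poly_family_continuous: "poly_family F \<Longrightarrow> continuous_on {0..} (F z)"
  by (induction rule: poly_family.induct) (auto intro!: continuous_intros)

lemma poly_family_holomorphic: "poly_family F \<Longrightarrow> (\<lambda>z. F z x $ i) holomorphic_on S"
  by (induction rule: poly_family.induct) (auto intro!: holomorphic_intros)

section \<open>Integration on the half-line\<close>

lemma integrable_on_halfline_interval:
  fixes f :: "real \<Rightarrow> 'e::banach"
  shows "continuous_on {0..} f \<Longrightarrow> f integrable_on {0..x}"
  by (rule integrable_continuous_real, erule continuous_on_subset) auto

lemma continuous_on_integral_halfline: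
  fixes f :: "real \<Rightarrow> 'e::banach"
  assumes "continuous_on {0..} f"
  shows "continuous_on {0..} (\<lambda>x. integral {0..x} f)"
  unfolding continuous_on_eq_continuous_within
proof
  fix x :: real assume x: "x \<in> {0..}"
  \<comment> \<open>Continuity is local, so an interval reaching past x may replace the
    half-line.\<close>
  have "continuous_on {0..x+1} (\<lambda>x. integral {0..x} f)"
    by (intro indefinite_integral_continuous_1 integrable_on_halfline_interval assms)
  then have "continuous (at x within {0..x+1}) (\<lambda>x. integral {0..x} f)"
    using x by (auto simp: continuous_on_eq_continuous_within)
  moreover have "at x within {0..x+1} = at x within {0..}"
    by (rule at_within_nhd[of _ "{x-1<..<x+1}"]) auto
  ultimately show "continuous (at x within {0..}) (\<lambda>x. integral {0..x} f)" by simp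
qed

lemma halfline_bounded_on_interval:
  fixes f :: "real \<Rightarrow> 'e::real_normed_vector"
  assumes "continuous_on {0..} f"
  obtains a where "\<And>t. t \<in> {0..X} \<Longrightarrow> norm (f t) \<le> a"
proof -
  have "continuous_on {0..X} f" by (rule continuous_on_subset[OF assms]) auto
  then have "bounded (f ` {0..X})"
    by (intro compact_imp_bounded compact_continuous_image compact_Icc)
  then show thesis using that by (force simp: bounded_iff)
qed

section \<open>The Picard series\<close>

context
  fixes A :: "real \<Rightarrow> complex^'n::finite^'n" and B :: "complex^'n^'n"
  assumes contA: "continuous_on {0..} A"
begin

text \<open>Right-hand side of y' = (A(t) + z B) y. For the Dirac system, A is the coefficient at z
  = 0 and B is i J.\<close>

definition lin_coeff :: "complex \<Rightarrow> real \<Rightarrow> complex^'n \<Rightarrow> complex^'n" where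
  "lin_coeff z t y = A t *v y + z *s (B *v y)"

lemma continuous_on_lin_coeff:
  assumes "continuous_on {0..} f" shows "continuous_on {0..} (\<lambda>t. lin_coeff z t (f t))"
  unfolding lin_coeff_def by (intro continuous_intros contA assms)

lemma lin_coeff_add: "lin_coeff z t (f + g) = lin_coeff z t f + lin_coeff z t g"
  by (simp add: lin_coeff_def matrix_vector_right_distrib vector_add_ldistrib)

lemma lin_coeff_sum: "lin_coeff z t (\<Sum>i\<in>I. f i) = (\<Sum>i\<in>I. lin_coeff z t (f i))"
proof (induction I rule: infinite_finite_induct)
  case (insert i I) then show ?case by (simp add: lin_coeff_add)
qed (auto simp: lin_coeff_def)

lemma norm_lin_coeff:
  assumes "norm (A t) \<le> a" "cmod z \<le> R"
  shows "norm (lin_coeff z t y) \<le> (a + R * norm B) * norm y"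
proof -
  have "norm (lin_coeff z t y) \<le> norm (A t) * norm y + cmod z * (norm B * norm y)"
    unfolding lin_coeff_def
    by (intro norm_triangle_mono norm_matrix_vector_mult_le)
       (simp add: norm_vector_scalar_mult mult_left_mono norm_matrix_vector_mult_le)
  also have "\<dots> \<le> a * norm y + R * (norm B * norm y)"
    using assms by (intro add_mono mult_right_mono) auto
  finally show ?thesis by (simp add: algebra_simps)
qed

text \<open>Terms of the Neumann series: differences of consecutive Picard iterates started at the
  constant k. The iterates are the partial sums.\<close>

fun picard_term :: "complex^'n \<Rightarrow> nat \<Rightarrow> complex \<Rightarrow> real \<Rightarrow> complex^'n" where
  "picard_term k 0 z x = k"
| "picard_term k (Suc n) z x = integral {0..x} (\<lambda>t. lin_coeff z t (picard_term k n z t))"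

text \<open>A keeps the power of z and z B raises it by one; powers of z do not depend on the
  integration variable and leave the integral.\<close>

lemma poly_family_integral_lin_coeff:
  "poly_family F \<Longrightarrow> poly_family (\<lambda>z x. integral {0..x} (\<lambda>t. lin_coeff z t (F z t)))"
proof (induction rule: poly_family.induct)
  case (monom c e)
  have c1: "continuous_on {0..} (\<lambda>t. A t *v c t)" "continuous_on {0..} (\<lambda>t. B *v c t)"
    by (intro continuous_intros monom contA)+
  have "integral {0..x} (\<lambda>t. lin_coeff z t (z ^ e *s c t)) =
      z ^ e *s integral {0..x} (\<lambda>t. A t *v c t) + z ^ Suc e *s integral {0..x} (\<lambda>t. B *v c t)" for z x
  proof -
    have "lin_coeff z t (z ^ e *s c t) = z ^ e *s (A t *v c t) + z ^ Suc e *s (B *v c t)" for t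
      by (simp add: lin_coeff_def vector_scalar_commute vector_smult_assoc)
    moreover have "((\<lambda>t. w *s f t) has_integral w *s integral {0..x} f) {0..x}"
      if "continuous_on {0..} f" for w and f :: "real \<Rightarrow> complex^'n"
      using has_integral_linear[OF integrable_integral[OF integrable_on_halfline_interval[OF that]]
          bounded_bilinear.bounded_linear_right[OF bounded_bilinear_vector_scalar_mult]]
      by (simp add: o_def)
    ultimately show ?thesis
      using c1 by (simp only:) (intro integral_unique has_integral_add, auto)
  qed
  then show ?case
    by (simp only:) (intro poly_family.intros continuous_on_integral_halfline c1)
next
  case (add F G)
  have "integral {0..x} (\<lambda>t. lin_coeff z t (F z t + G z t)) =
     integral {0..x} (\<lambda>t. lin_coeff z t (F z t)) + integral {0..x} (\<lambda>t. lin_coeff z t (G z t))" for z x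
    by (simp add: lin_coeff_add integral_add integrable_on_halfline_interval
        continuous_on_lin_coeff poly_family_continuous add)
  then show ?case by (simp only:) (intro poly_family.add add)
qed

lemma poly_family_picard_term: "poly_family (picard_term k n)"
proof (induction n)
  case 0
  have "picard_term k 0 = (\<lambda>z x. z ^ 0 *s k)"
    by (auto simp: fun_eq_iff)
  then show ?case by (simp only:) (intro poly_family.intros continuous_intros)
next
  case (Suc n)
  have "picard_term k (Suc n) = (\<lambda>z x. integral {0..x} (\<lambda>t. lin_coeff z t (picard_term k n z t)))"
    by (auto simp: fun_eq_iff)
  then show ?case using poly_family_integral_lin_coeff[OF Suc] by simp
qed

text \<open>Each integration turns t^n / n! into x^(n+1) / (n+1)!. Writing the bound with
  \<open>/\<^sub>R fact n\<close> matches \<open>summable_exp_generic\<close>.\<close>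

lemma norm_picard_term_le:
  assumes "\<And>t. t \<in> {0..X} \<Longrightarrow> norm (A t) \<le> a" "cmod z \<le> R" "x \<in> {0..X}"
  shows "norm (picard_term k n z x) \<le> norm k * (((a + R * norm B) * x) ^ n /\<^sub>R fact n)"
  using \<open>x \<in> {0..X}\<close>
proof (induction n arbitrary: x)
  case (Suc n)
  define L where "L = a + R * norm B"
  have "0 \<le> a" using assms(1)[of x] Suc.prems norm_ge_zero order_trans by blast
  moreover have "0 \<le> R" using assms(2) norm_ge_zero order_trans by blast
  ultimately have L: "0 \<le> L" by (simp add: L_def)
  have "((\<lambda>t. (norm k * L ^ Suc n / fact n) * t ^ n) has_integral
      (norm k * L ^ Suc n / fact n) * (x ^ Suc n / Suc n)) {0..x}"
  proof (intro has_integral_mult_right)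
    have "((\<lambda>t. t ^ n) has_integral (x ^ Suc n / Suc n - 0 ^ Suc n / Suc n)) {0..x}"
      using Suc.prems
      by (intro fundamental_theorem_of_calculus)
        (auto simp flip: has_real_derivative_iff_has_vector_derivative simp del: power_Suc
          intro!: derivative_eq_intros)
    then show "((\<lambda>t. t ^ n) has_integral (x ^ Suc n / Suc n)) {0..x}" by simp
  qed
  moreover have "(norm k * L ^ Suc n / fact n) * (x ^ Suc n / Suc n) = norm k * ((L * x) ^ Suc n /\<^sub>R fact (Suc n))"
    by (simp add: power_mult_distrib divide_inverse mult_ac)
  ultimately have I: "integral {0..x} (\<lambda>t. (norm k * L ^ Suc n / fact n) * t ^ n) = norm k * ((L * x) ^ Suc n /\<^sub>R fact (Suc n))"
    and J: "(\<lambda>t. (norm k * L ^ Suc n / fact n) * t ^ n) integrable_on {0..x}"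
    by (metis integral_unique, metis has_integral_integrable)
  have "norm (picard_term k (Suc n) z x) \<le> integral {0..x} (\<lambda>t. (norm k * L ^ Suc n / fact n) * t ^ n)"
    unfolding picard_term.simps
  proof (rule integral_norm_bound_integral[OF _ J])
    show "(\<lambda>t. lin_coeff z t (picard_term k n z t)) integrable_on {0..x}"
      by (intro integrable_on_halfline_interval continuous_on_lin_coeff poly_family_continuous
          poly_family_picard_term)
    fix t assume t: "t \<in> {0..x}"
    then have t': "t \<in> {0..X}" using Suc.prems by auto
    have "norm (lin_coeff z t (picard_term k n z t)) \<le> L * norm (picard_term k n z t)"
      unfolding L_def using assms t' by (intro norm_lin_coeff) auto
    also have "\<dots> \<le> L * (norm k * ((L * t) ^ n /\<^sub>R fact n))"
      using Suc.IH[OF t'] L by (intro mult_left_mono) (auto simp: L_def)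
    finally show "norm (lin_coeff z t (picard_term k n z t)) \<le> (norm k * L ^ Suc n / fact n) * t ^ n"
      by (simp add: field_simps power_mult_distrib)
  qed
  then show ?case unfolding I by (simp add: L_def)
qed simp

text \<open>Uniformity is needed jointly: in x to pass to the limit under the integral, in z so that
  the limit stays holomorphic.\<close>

lemma uniform_limit_picard:
  assumes "X \<ge> 0"
  shows "uniform_limit (cball 0 R \<times> {0..X}) (\<lambda>n (z, x). \<Sum>i<n. picard_term k i z x)
           (\<lambda>(z, x). \<Sum>i. picard_term k i z x) sequentially"
proof -
  obtain a where a: "\<And>t. t \<in> {0..X} \<Longrightarrow> norm (A t) \<le> a"
    using halfline_bounded_on_interval[OF contA] by blast
  have a0: "0 \<le> a" using a[of 0] assms by (auto intro: order_trans[OF norm_ge_zero])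
  have "uniform_limit (cball 0 R \<times> {0..X}) (\<lambda>n p. \<Sum>i<n. (\<lambda>(z, x). picard_term k i z x) p)
           (\<lambda>p. \<Sum>i. (\<lambda>(z, x). picard_term k i z x) p) sequentially"
  proof (rule Weierstrass_m_test)
    show "summable (\<lambda>n. norm k * (((a + R * norm B) * X) ^ n /\<^sub>R fact n))"
      by (intro summable_mult summable_exp_generic)
    fix n p assume "p \<in> cball (0::complex) R \<times> {0..X}"
    then obtain z x where p: "p = (z, x)" "cmod z \<le> R" "x \<in> {0..X}" by (auto simp: dist_norm)
    have R0: "0 \<le> R" using p(2) norm_ge_zero order_trans by blast
    have "norm (picard_term k n z x) \<le> norm k * (((a + R * norm B) * x) ^ n /\<^sub>R fact n)"
      by (rule norm_picard_term_le[OF a p(2,3)])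
    also have "\<dots> \<le> norm k * (((a + R * norm B) * X) ^ n /\<^sub>R fact n)"
      using p a0 R0 by (intro mult_left_mono scaleR_left_mono power_mono) auto
    finally show "norm ((\<lambda>(z, x). picard_term k n z x) p) \<le> norm k * (((a + R * norm B) * X) ^ n /\<^sub>R fact n)"
      by (simp add: p)
  qed
  then show ?thesis by (simp add: case_prod_unfold)
qed

lemma linear_ode_entire_solution:
  fixes k :: "complex^'n"
  obtains u where "\<And>z. u z (0::real) = k"
    and "\<And>z x. x \<ge> 0 \<Longrightarrow> (u z has_vector_derivative (A x *v u z x + z *s (B *v u z x))) (at x within {0..})"
    and "\<And>x i. x \<ge> 0 \<Longrightarrow> (\<lambda>z. u z x $ i) holomorphic_on UNIV"
proof
  define u where "u = (\<lambda>z x. \<Sum>i. picard_term k i z x)"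
  have unif: "uniform_limit {0..X} (\<lambda>n x. \<Sum>i<n. picard_term k i z x) (u z) sequentially"
    if "X \<ge> 0" for z X
  proof (rule uniform_limitI)
    fix e :: real assume "e > 0"
    from uniform_limitD[OF uniform_limit_picard[OF that, where R = "cmod z" and k = k] this]
    show "\<forall>\<^sub>F n in sequentially. \<forall>x\<in>{0..X}. dist (\<Sum>i<n. picard_term k i z x) (u z x) < e"
      by eventually_elim (auto simp: u_def)
  qed
  have contS: "continuous_on {0..X} (\<lambda>x. \<Sum>i<n. picard_term k i z x)" for n z X
    by (intro continuous_on_sum continuous_on_subset[OF poly_family_continuous[OF poly_family_picard_term]]) auto
  have contu: "continuous_on {0..X} (u z)" if "X \<ge> 0" for z X
    using unif[OF that] contS by (intro uniform_limit_theorem[of _ _ sequentially]) auto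
  have pt0: "picard_term k i z 0 = (if i = 0 then k else 0)" for i z
    by (cases i) auto
  show u0: "u z 0 = k" for z
    using suminf_finite[of "{0}" "\<lambda>i. picard_term k i z 0"] by (simp add: u_def pt0)
  \<comment> \<open>The integral equation comes first; the differential equation then follows from
    the fundamental theorem of calculus.\<close>
  have eq: "u z x = k + integral {0..x} (\<lambda>t. lin_coeff z t (u z t))" if "x \<ge> 0" for z x
  proof -
    have bl: "bounded_linear (lin_coeff z t)" for t
      unfolding lin_coeff_def
      by (intro bounded_linear_add
          bounded_bilinear.bounded_linear_right[OF bounded_bilinear_matrix_vector_mult]
          bounded_linear_compose[OF bounded_bilinear.bounded_linear_right[OF bounded_bilinear_vector_scalar_mult]])
    obtain a where a: "\<And>t. t \<in> {0..x} \<Longrightarrow> norm (A t) \<le> a"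
      using halfline_bounded_on_interval[OF contA] by blast
    \<comment> \<open>The summand 1 makes L positive, so that e / L is an admissible
      tolerance.\<close>
    define L where "L = \<bar>a + cmod z * norm B\<bar> + 1"
    have L: "L > 0" by (simp add: L_def)
    have nL: "norm (lin_coeff z t y) \<le> L * norm y" if "t \<in> {0..x}" for t y
      by (rule order_trans[OF norm_lin_coeff[OF a[OF that] order_refl]])
         (auto simp: L_def intro!: mult_right_mono)
    have "uniform_limit {0..x} (\<lambda>n t. lin_coeff z t (\<Sum>i<n. picard_term k i z t))
        (\<lambda>t. lin_coeff z t (u z t)) sequentially"
    proof (rule uniform_limitI)
      fix e :: real assume "e > 0"
      then have "\<forall>\<^sub>F n in sequentially. \<forall>t\<in>{0..x}. dist (\<Sum>i<n. picard_term k i z t) (u z t) < e / L"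
        using L by (intro uniform_limitD[OF unif[OF that]]) auto
      then show "\<forall>\<^sub>F n in sequentially. \<forall>t\<in>{0..x}.
          dist (lin_coeff z t (\<Sum>i<n. picard_term k i z t)) (lin_coeff z t (u z t)) < e"
      proof eventually_elim
        case (elim n)
        show ?case
        proof
          fix t assume t: "t \<in> {0..x}"
          have "dist (lin_coeff z t (\<Sum>i<n. picard_term k i z t)) (lin_coeff z t (u z t))
            \<le> L * dist (\<Sum>i<n. picard_term k i z t) (u z t)"
            using nL[OF t] by (simp add: dist_norm flip: linear_diff[OF bounded_linear.linear[OF bl]])
          also have "\<dots> < L * (e / L)" using elim t L by (intro mult_strict_left_mono) auto
          finally show "dist (lin_coeff z t (\<Sum>i<n. picard_term k i z t)) (lin_coeff z t (u z t)) < e"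
            using L by simp
        qed
      qed
    qed
    moreover have "continuous_on {0..x} (\<lambda>t. lin_coeff z t (\<Sum>i<n. picard_term k i z t))" for n
      unfolding lin_coeff_def
      by (intro continuous_intros contS continuous_on_subset[OF contA]) auto
    ultimately obtain I J where IJ:
      "\<And>n. ((\<lambda>t. lin_coeff z t (\<Sum>i<n. picard_term k i z t)) has_integral I n) {0..x}"
      "((\<lambda>t. lin_coeff z t (u z t)) has_integral J) {0..x}" "I \<longlonglongrightarrow> J"
      by (rule uniform_limit_integral) auto
    have "I n = (\<Sum>i<n. picard_term k (Suc i) z x)" for n
    proof -
      have "((\<lambda>t. \<Sum>i<n. lin_coeff z t (picard_term k i z t)) has_integral
         (\<Sum>i<n. picard_term k (Suc i) z x)) {0..x}"
        unfolding picard_term.simps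
        by (intro has_integral_sum integrable_integral integrable_on_halfline_interval
            continuous_on_lin_coeff poly_family_continuous poly_family_picard_term) auto
      then show ?thesis using has_integral_unique[OF IJ(1)[of n]] by (simp only: lin_coeff_sum)
    qed
    \<comment> \<open>Term i+1 is the integral of term i, so k plus the first n integrals is the
      partial sum with n+1 terms.\<close>
    then have "(\<lambda>n. k + (\<Sum>i<n. picard_term k (Suc i) z x)) \<longlonglongrightarrow> k + J"
      using tendsto_add[OF tendsto_const IJ(3), of k] by presburger
    then have "(\<lambda>n. \<Sum>i<Suc n. picard_term k i z x) \<longlonglongrightarrow> k + J"
      by (simp only: sum.lessThan_Suc_shift picard_term.simps)
    then have "(\<lambda>n. \<Sum>i<n. picard_term k i z x) \<longlonglongrightarrow> k + J"
      by (rule LIMSEQ_imp_Suc)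
    moreover have "(\<lambda>n. \<Sum>i<n. picard_term k i z x) \<longlonglongrightarrow> u z x"
      using tendsto_uniform_limitI[OF unif[OF that]] that by simp
    ultimately have "u z x = k + J" by (rule LIMSEQ_unique[rotated])
    then show ?thesis using IJ(2) by (simp add: integral_unique)
  qed
  show "(u z has_vector_derivative (A x *v u z x + z *s (B *v u z x))) (at x within {0..})"
    if x: "x \<ge> 0" for z x
  proof -
    have "continuous_on {0..x+1} (\<lambda>t. lin_coeff z t (u z t))"
      unfolding lin_coeff_def using x
      by (intro continuous_intros contu continuous_on_subset[OF contA]) auto
    then have "((\<lambda>x. k + integral {0..x} (\<lambda>t. lin_coeff z t (u z t))) has_vector_derivative
        lin_coeff z x (u z x)) (at x within {0..x+1})"
      using x by (auto intro!: derivative_eq_intros integral_has_vector_derivative)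
    then have "(u z has_vector_derivative lin_coeff z x (u z x)) (at x within {0..x+1})"
      by (rule has_vector_derivative_transform[rotated 2]) (use x eq in auto)
    moreover have "at x within {0..x+1} = at x within {0..}"
      using x by (intro at_within_nhd[of _ "{x-1<..<x+1}"]) auto
    ultimately show ?thesis by (simp add: lin_coeff_def)
  qed
  show "(\<lambda>z. u z x $ i) holomorphic_on UNIV" if x: "x \<ge> 0" for x i
  proof (rule holomorphic_uniform_sequence)
    show "(\<lambda>z. (\<Sum>j<n. picard_term k j z x) $ i) holomorphic_on UNIV" for n
      by (auto intro!: holomorphic_intros poly_family_holomorphic poly_family_picard_term)
    fix z0 :: complex
    have "uniform_limit (cball 0 (cmod z0 + 1)) (\<lambda>n z. \<Sum>j<n. picard_term k j z x) (\<lambda>z. u z x) sequentially"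
    proof (rule uniform_limitI)
      fix e :: real assume "e > 0"
      from uniform_limitD[OF uniform_limit_picard[OF x, where R = "cmod z0 + 1" and k = k] this]
      show "\<forall>\<^sub>F n in sequentially. \<forall>z\<in>cball 0 (cmod z0 + 1).
          dist (\<Sum>j<n. picard_term k j z x) (u z x) < e"
        by eventually_elim (use x in \<open>auto simp: u_def\<close>)
    qed
    then have "uniform_limit (cball z0 1) (\<lambda>n z. \<Sum>j<n. picard_term k j z x) (\<lambda>z. u z x) sequentially"
      by (rule uniform_limit_on_subset) (metis (no_types) add.commute cball_subset_cball_iff dist_0_norm order_refl dist_commute)
    then have "uniform_limit (cball z0 1) (\<lambda>n z. (\<Sum>j<n. picard_term k j z x) $ i) (\<lambda>z. u z x $ i) sequentially"
      by (rule bounded_linear.uniform_limit[OF bounded_linear_vec_nth])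
    then show "\<exists>d>0. cball z0 d \<subseteq> UNIV \<and>
       uniform_limit (cball z0 d) (\<lambda>n z. (\<Sum>j<n. picard_term k j z x) $ i) (\<lambda>z. u z x $ i) sequentially"
      by (intro exI[of _ 1]) auto
  qed auto
qed

end

section \<open>Phragmen-Lindelof in a sector\<close>

text \<open>In logarithmic coordinates a sector outside the unit disc is a half-strip, and the classical
  damping factor exp(-e z^beta) involves no branch of a fractional power.\<close>

lemma phragmen_lindelof_half_strip:
  fixes F :: "complex \<Rightarrow> complex"
  assumes hol: "F holomorphic_on UNIV" and M: "M > 0" and K: "K > 0" and ab: "a < b" "b - a < pi"
    and growth: "\<And>z. \<lbrakk>0 \<le> Re z; a \<le> Im z; Im z \<le> b\<rbrakk> \<Longrightarrow> cmod (F z) \<le> C * exp (K * exp (Re z))"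
    and left: "\<And>y. \<lbrakk>a \<le> y; y \<le> b\<rbrakk> \<Longrightarrow> cmod (F (Complex 0 y)) \<le> M"
    and bottom: "\<And>x. 0 \<le> x \<Longrightarrow> cmod (F (Complex x a)) \<le> M"
    and top: "\<And>x. 0 \<le> x \<Longrightarrow> cmod (F (Complex x b)) \<le> M"
    and z: "0 \<le> Re z" "a \<le> Im z" "Im z \<le> b"
  shows "cmod (F z) \<le> M"
proof -
  \<comment> \<open>The midpoint of 1 and pi / (b - a). Above 1, the damping beats exp(K exp(Re z));
    below pi / (b - a), the cosine in Re h stays positive on the strip.\<close>
  define \<beta> where "\<beta> = (1 + pi / (b - a)) / 2"
  have "1 < pi / (b - a)" using ab by (simp add: field_simps)
  then have \<beta>: "1 < \<beta>" "\<beta> < pi / (b - a)" unfolding \<beta>_def by argo+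
  define \<delta> where "\<delta> = cos (\<beta> * (b - a) / 2)"
  have ang: "0 \<le> \<beta> * (b - a) / 2" "\<beta> * (b - a) / 2 < pi / 2"
    using \<beta> ab by (auto simp: field_simps)
  then have \<delta>: "\<delta> > 0" unfolding \<delta>_def by (intro cos_gt_zero_pi) auto
  \<comment> \<open>Centring at the middle line of the strip keeps the argument of h within \<beta>
    (b - a) / 2 on either side of 0.\<close>
  define h where "h = (\<lambda>w. exp (of_real \<beta> * (w - \<i> * of_real ((a + b) / 2))))"
  have Re_h: "Re (h w) \<ge> \<delta> * exp (\<beta> * Re w)" if "a \<le> Im w" "Im w \<le> b" for w
  proof -
    have "\<bar>\<beta> * (Im w - (a + b) / 2)\<bar> \<le> \<beta> * (b - a) / 2"
    proof -
      have "\<bar>Im w - (a + b) / 2\<bar> \<le> (b - a) / 2" using that by (auto simp: abs_le_iff field_simps)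
      then have "\<beta> * \<bar>Im w - (a + b) / 2\<bar> \<le> \<beta> * ((b - a) / 2)"
        using \<beta> by (intro mult_left_mono) auto
      then show ?thesis using \<beta> by (simp add: abs_mult)
    qed
    then have "\<delta> \<le> cos \<bar>\<beta> * (Im w - (a + b) / 2)\<bar>"
      unfolding \<delta>_def using ang by (intro cos_monotone_0_pi_le) auto
    then have "\<delta> \<le> cos (\<beta> * (Im w - (a + b) / 2))" by (simp only: cos_abs_real)
    then show ?thesis by (simp add: h_def Re_exp)
  qed
  have C: "C \<ge> 0"
  proof -
    have "0 \<le> C * exp (K * exp 0)"
      using growth[of "Complex 0 a"] ab norm_ge_zero[of "F (Complex 0 a)"]
      by (simp del: norm_ge_zero)
    then show ?thesis by (simp add: zero_le_mult_iff)
  qed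
  have main: "cmod (F z * exp (- of_real e * h z)) \<le> M" if e: "e > 0" for e
  proof -
    define d where "d = e * \<delta>"
    have d: "d > 0" using e \<delta> by (simp add: d_def)
    define c where "c = \<beta> - 1"
    have c: "c > 0" using \<beta> by (simp add: c_def)
    \<comment> \<open>R is taken so large that the damped exponent at Re w = R is at most -exp R,
      hence at most -R, while C exp(-R) < M.\<close>
    have "((\<lambda>t. C * exp (- t)) \<longlongrightarrow> 0) at_top" by real_asymp
    then have "\<forall>\<^sub>F t in at_top. C * exp (- t) < M"
      using M by (rule order_tendstoD)
    moreover have "filterlim (\<lambda>t. exp (c * t)) at_top at_top"
      using c by real_asymp
    then have "\<forall>\<^sub>F t in at_top. (K + 1) / d \<le> exp (c * t)"
      by (simp add: filterlim_at_top)
    ultimately have "\<forall>\<^sub>F t in at_top. C * exp (- t) < M \<and> (K + 1) / d \<le> exp (c * t) \<and> t > Re z"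
      using eventually_gt_at_top by (intro eventually_conj) auto
    then obtain R where R': "C * exp (- R) < M" "(K + 1) / d \<le> exp (c * R)" and "Re z < R"
      using eventually_happens'[OF trivial_limit_at_top_linorder] by blast
    have "K * exp R - d * exp (\<beta> * R) = exp R * (K - d * exp (c * R))"
      by (simp add: c_def algebra_simps flip: exp_add)
    also have "\<dots> \<le> exp R * (- 1)"
      using R'(2) d by (intro mult_left_mono) (auto simp: field_simps)
    also have "\<dots> \<le> - R" using exp_ge_add_one_self[of R] by linarith
    finally have "C * exp (K * exp R - d * exp (\<beta> * R)) \<le> C * exp (- R)"
      using C by (intro mult_left_mono) auto
    then have R: "C * exp (K * exp R - (e * \<delta>) * exp (\<beta> * R)) < M" "Re z < R"
      using R' \<open>Re z < R\<close> by (auto simp: d_def)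
    define G where "G = (\<lambda>w. F w * exp (- of_real e * h w))"
    have normG: "cmod (G w) \<le> cmod (F w) * exp (- (e * \<delta>) * exp (\<beta> * Re w))"
      if "a \<le> Im w" "Im w \<le> b" for w
      using Re_h[OF that] e by (auto simp: G_def norm_mult intro!: mult_left_mono)
    have normG': "cmod (G w) \<le> M" if "a \<le> Im w" "Im w \<le> b" "cmod (F w) \<le> M" for w
    proof -
      have "exp (- (e * \<delta>) * exp (\<beta> * Re w)) \<le> 1" using e \<delta> by simp
      then have "cmod (F w) * exp (- (e * \<delta>) * exp (\<beta> * Re w)) \<le> M * 1"
        using that M by (intro mult_mono) auto
      then have "cmod (G w) \<le> M * 1" using normG[OF that(1,2)] by (rule order_trans[rotated])
      then show ?thesis by simp
    qed
    \<comment> \<open>The growth bound is used on the right edge alone; the other three edges lie on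
      the boundary of the half-strip.\<close>
    let ?Q = "cbox (Complex 0 a) (Complex R b)"
    have holG: "G holomorphic_on UNIV"
      unfolding G_def h_def by (intro holomorphic_intros hol)
    have "cmod (G z) \<le> M"
    proof (rule maximum_modulus_frontier[of G ?Q])
      show "G holomorphic_on interior ?Q" using holG holomorphic_on_subset by blast
      show "continuous_on (closure ?Q) G"
        using holG holomorphic_on_imp_continuous_on continuous_on_subset by blast
      show "bounded ?Q" by (rule bounded_cbox)
      show "z \<in> ?Q" using z R by (auto simp: in_cbox_complex_iff)
      fix w assume "w \<in> frontier ?Q"
      then have "w \<in> ?Q - box (Complex 0 a) (Complex R b)" by (simp add: frontier_cbox)
      then have w: "0 \<le> Re w" "Re w \<le> R" "a \<le> Im w" "Im w \<le> b"
        "Re w = 0 \<or> Re w = R \<or> Im w = a \<or> Im w = b"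
        by (auto simp: in_cbox_complex_iff in_box_complex_iff)
      show "cmod (G w) \<le> M"
      proof (cases "Re w = R")
        case True
        have "cmod (G w) \<le> (C * exp (K * exp R)) * exp (- (e * \<delta>) * exp (\<beta> * R))"
          by (rule order_trans[OF normG]) (use w True growth[of w] in \<open>auto intro!: mult_right_mono\<close>)
        also have "\<dots> = C * exp (K * exp R - (e * \<delta>) * exp (\<beta> * R))"
          by (simp add: exp_diff exp_minus divide_inverse)
        finally show ?thesis using R by simp
      next
        case False
        then have "w = Complex 0 (Im w) \<or> w = Complex (Re w) a \<or> w = Complex (Re w) b"
          using w by (auto simp: complex_eq_iff)
        then have "cmod (F w) \<le> M" using left bottom top w by metis
        then show ?thesis using normG' w by blast
      qed
    qed
    then show ?thesis by (simp add: G_def)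
  qed
  \<comment> \<open>R depended on e but the bound M does not, so e may tend to 0 with z
    fixed.\<close>
  have "((\<lambda>e. cmod (F z * exp (- of_real e * h z))) \<longlongrightarrow> cmod (F z * exp (- of_real 0 * h z))) (at_right 0)"
    by (intro tendsto_intros)
  then have "cmod (F z * exp (- of_real 0 * h z)) \<le> M"
  proof (rule tendsto_upperbound)
    show "\<forall>\<^sub>F e in at_right 0. cmod (F z * exp (- of_real e * h z)) \<le> M"
      using eventually_at_right_less by eventually_elim (rule main)
  qed simp
  then show ?thesis by simp
qed

text \<open>Under z = exp w, exponential type becomes the growth exp(K exp(Re w)) allowed in a
  half-strip of width below pi. The ray cuts 0 <= Im w <= pi into two such half-strips; compactness
  handles the unit disc, whose boundary supplies the left edges.\<close>

lemma bounded_upper_half_plane: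
  fixes f :: "complex \<Rightarrow> complex"
  assumes hol: "f holomorphic_on UNIV"
    and growth: "\<And>z. Im z \<ge> 0 \<Longrightarrow> cmod (f z) \<le> C * exp (K * cmod z)"
    and real: "\<And>x. cmod (f (of_real x)) \<le> M1"
    and ray: "\<And>t. t \<ge> 1 \<Longrightarrow> cmod (f (of_real t * cis \<theta>)) \<le> M2"
    and \<theta>: "0 < \<theta>" "\<theta> < pi" and K: "K > 0"
  shows "\<exists>M. \<forall>z. Im z \<ge> 0 \<longrightarrow> cmod (f z) \<le> M"
proof -
  have "bounded (f ` cball 0 1)"
    using hol by (intro compact_imp_bounded compact_continuous_image holomorphic_on_imp_continuous_on
        holomorphic_on_subset[OF hol]) auto
  then obtain M0 where M0: "\<And>z. cmod z \<le> 1 \<Longrightarrow> cmod (f z) \<le> M0"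
    by (fastforce simp: bounded_iff)
  \<comment> \<open>The entry 1 makes M positive, as the half-strip lemma requires.\<close>
  define M where "M = max M0 (max M1 (max M2 1))"
  have M: "M0 \<le> M" "M1 \<le> M" "M2 \<le> M" "M > 0" by (auto simp: M_def)
  define F where "F = (\<lambda>w. f (exp w))"
  have holF: "F holomorphic_on UNIV" unfolding F_def
    by (rule holomorphic_on_compose_gen[of exp UNIV f UNIV, unfolded o_def]) (auto intro!: holomorphic_intros hol)
  have Fexp: "F (Complex x y) = f (of_real (exp x) * cis y)" for x y
    by (simp add: F_def exp_eq_polar)
  have sector: "cmod (F w) \<le> M"
    if ab: "a < b" "b - a < pi" "0 \<le> a" "b \<le> pi" "a \<in> {0, \<theta>}" "b \<in> {\<theta>, pi}"
      and w: "0 \<le> Re w" "a \<le> Im w" "Im w \<le> b" for a b w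
  proof (rule phragmen_lindelof_half_strip[OF holF \<open>M > 0\<close> K ab(1,2) _ _ _ _ w])
    have edge: "cmod (F (Complex x y)) \<le> M" if "0 \<le> x" "y \<in> {0, \<theta>, pi}" for x y
    proof -
      have "cis pi = -1" by (simp add: complex_eq_iff)
      then have "F (Complex x 0) = f (of_real (exp x))" "F (Complex x pi) = f (of_real (- exp x))"
        by (simp_all add: Fexp)
      moreover have "cmod (F (Complex x \<theta>)) \<le> M"
        unfolding Fexp using ray[of "exp x"] that(1) M by auto
      ultimately show ?thesis using that real M order_trans by (metis insertE singletonD)
    qed
    show "cmod (F (Complex x a)) \<le> M" "cmod (F (Complex x b)) \<le> M" if "0 \<le> x" for x
      using that ab edge by auto
    show "cmod (F (Complex 0 y)) \<le> M" for y
      using M0[of "cis y"] M by (simp add: Fexp)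
    show "cmod (F z) \<le> C * exp (K * exp (Re z))" if "0 \<le> Re z" "a \<le> Im z" "Im z \<le> b" for z
      using growth[of "exp z"] that ab by (simp add: F_def Im_exp sin_ge_zero)
  qed
  have "cmod (f z) \<le> M" if z: "Im z \<ge> 0" for z
  proof (cases "cmod z \<le> 1")
    case True then show ?thesis using M0 M order_trans by blast
  next
    case False
    then have "z \<noteq> 0" by auto
    have "0 \<le> Re (Ln z)" using False \<open>z \<noteq> 0\<close> by simp
    have "0 \<le> Im (Ln z)" "Im (Ln z) \<le> pi"
      using Im_Ln_pos_le[OF \<open>z \<noteq> 0\<close>] z Im_Ln_le_pi[OF \<open>z \<noteq> 0\<close>] by auto
    have "cmod (F (Ln z)) \<le> M"
    proof (cases "Im (Ln z) \<le> \<theta>")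
      case True
      with \<open>0 \<le> Re (Ln z)\<close> \<open>0 \<le> Im (Ln z)\<close> show ?thesis
        by (intro sector[of 0 \<theta>]) (use \<theta> in auto)
    next
      case False
      with \<open>0 \<le> Re (Ln z)\<close> \<open>Im (Ln z) \<le> pi\<close> show ?thesis
        by (intro sector[of \<theta> pi]) (use \<theta> in auto)
    qed
    then show ?thesis using \<open>z \<noteq> 0\<close> by (simp add: F_def)
  qed
  then show ?thesis by blast
qed

section \<open>Energy estimates and Weyl solutions\<close>

definition upper_part :: "complex^('a::finite + 'b::finite) \<Rightarrow> complex^'a" where
  "upper_part f = (\<chi> a. f $ Inl a)"

definition lower_part :: "complex^('a::finite + 'b::finite) \<Rightarrow> complex^'b" where
  "lower_part f = (\<chi> b. f $ Inr b)"

definition vjoin :: "complex^'a \<Rightarrow> complex^'b \<Rightarrow> complex^('a::finite + 'b::finite)" where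
  "vjoin h g = (\<chi> i. case i of Inl a \<Rightarrow> h $ a | Inr b \<Rightarrow> g $ b)"

definition herm :: "complex^'n::finite \<Rightarrow> complex^'n \<Rightarrow> complex" where
  "herm g f = (\<Sum>i\<in>UNIV. cnj (g $ i) * f $ i)"

definition adjoint_mat :: "complex^'b::finite^'a::finite \<Rightarrow> complex^'a^'b" where
  "adjoint_mat A = (\<chi> i j. cnj (A $ j $ i))"

lemma sum_UNIV_Plus:
  fixes g :: "'a::finite + 'b::finite \<Rightarrow> 'c::comm_monoid_add"
  shows "(\<Sum>i\<in>UNIV. g i) = (\<Sum>a\<in>UNIV. g (Inl a)) + (\<Sum>b\<in>UNIV. g (Inr b))"
  by (subst UNIV_Plus_UNIV[symmetric], subst sum.Plus) (auto simp: o_def)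

lemma upper_lower_vjoin [simp]: "upper_part (vjoin h g) = h" "lower_part (vjoin h g) = g"
  by (auto simp: upper_part_def lower_part_def vjoin_def vec_eq_iff)

lemma vjoin_upper_lower [simp]: "vjoin (upper_part f) (lower_part f) = f"
  by (auto simp: upper_part_def lower_part_def vjoin_def vec_eq_iff split: sum.split)

lemma vjoin_add: "vjoin (h + h') (g + g') = vjoin h g + vjoin h' g'"
  by (auto simp: vjoin_def vec_eq_iff split: sum.split)

lemma power2_norm_vec: "(norm (x::complex^'n::finite))\<^sup>2 = (\<Sum>i\<in>UNIV. (cmod (x $ i))\<^sup>2)"
  by (simp add: norm_vec_def L2_set_def sum_nonneg)

lemma power2_norm_upper_lower: "(norm f)\<^sup>2 = (norm (upper_part f))\<^sup>2 + (norm (lower_part f))\<^sup>2"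
  by (simp add: power2_norm_vec sum_UNIV_Plus upper_part_def lower_part_def)

lemma norm_upper_le: "norm (upper_part f) \<le> norm f"
  by (rule power2_le_imp_le) (simp_all add: power2_norm_upper_lower[of f])

lemma norm_le_upper_lower: "norm f \<le> norm (upper_part f) + norm (lower_part f)"
  by (rule power2_le_imp_le) (auto simp: power2_norm_upper_lower power2_sum)

lemma norm_vjoin_0 [simp]: "norm (vjoin 0 g) = norm g" "norm (vjoin h 0) = norm h"
  using power2_norm_upper_lower[of "vjoin 0 g"] power2_norm_upper_lower[of "vjoin h 0"]
  by (auto simp: power2_eq_iff_nonneg)

lemma bounded_linear_upper: "bounded_linear upper_part" and bounded_linear_lower: "bounded_linear lower_part"
  unfolding linear_conv_bounded_linear[symmetric]
  by (rule linearI; simp add: upper_part_def lower_part_def vec_eq_iff)+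

lemma cmod_herm_le: "cmod (herm g f) \<le> norm g * norm f"
proof -
  have "norm (\<chi> i. cnj (g $ i)) = norm g" by (simp add: norm_vec_def)
  then show ?thesis using cmod_sum_mult_le[of "\<chi> i. cnj (g $ i)" f] by (simp add: herm_def)
qed

lemma bounded_bilinear_herm: "bounded_bilinear herm"
proof
  show "\<exists>K. \<forall>a b. cmod (herm a b) \<le> norm a * norm b * K"
    by (rule exI[of _ 1]) (simp add: cmod_herm_le)
qed (auto simp: herm_def algebra_simps sum.distrib scaleR_sum_right)

lemma herm_commute: "herm f g = cnj (herm g f)"
  by (simp add: herm_def mult.commute)

lemma herm_same: "herm f f = of_real ((norm f)\<^sup>2)"
  by (simp add: herm_def power2_norm_vec mult.commute flip: complex_norm_square)

lemma herm_simps: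
  "herm g (c *s f) = c * herm g f" "herm (c *s g) f = cnj c * herm g f"
  "herm g (f + f') = herm g f + herm g f'" "herm (g + g') f = herm g f + herm g' f"
  "herm 0 f = 0" "herm g 0 = 0"
  by (auto simp: herm_def sum_distrib_left algebra_simps sum.distrib)

lemma herm_adjoint_mat: "herm x (A *v y) = herm (adjoint_mat A *v x) y"
proof -
  have "herm x (A *v y) = (\<Sum>i\<in>UNIV. \<Sum>j\<in>UNIV. cnj (x $ i) * (A $ i $ j * y $ j))"
    by (simp add: herm_def matrix_vector_mult_def sum_distrib_left)
  also have "\<dots> = (\<Sum>j\<in>UNIV. \<Sum>i\<in>UNIV. cnj (x $ i) * (A $ i $ j * y $ j))"
    by (rule sum.swap)
  also have "\<dots> = herm (adjoint_mat A *v x) y"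
    by (simp add: herm_def adjoint_mat_def matrix_vector_mult_def sum_distrib_left sum_distrib_right mult_ac)
  finally show ?thesis .
qed

lemma adjoint_mat_idem [simp]: "adjoint_mat (adjoint_mat A) = A"
  by (simp add: adjoint_mat_def vec_eq_iff)

section \<open>Block form and energy identities of the Dirac system\<close>

lemma dirac_coeff_entry:
  "dirac_coeff v z x $ Inl a $ Inl a' = (if a = a' then \<i> * z else 0)"
  "dirac_coeff v z x $ Inl a $ Inr b = \<i> * v x $ a $ b"
  "dirac_coeff v z x $ Inr b $ Inl a = - \<i> * cnj (v x $ a $ b)"
  "dirac_coeff v z x $ Inr b $ Inr b' = (if b = b' then - \<i> * z else 0)"
  by (auto simp: dirac_coeff_def matrix_matrix_mult_def dirac_J_def dirac_V_def sum_UNIV_Plus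
      if_distrib[of "\<lambda>x. x * _"] cong: if_cong)

lemma dirac_coeff_upper:
  "upper_part (dirac_coeff v z x *v f) = (\<i> * z) *s upper_part f + \<i> *s (v x *v lower_part f)"
  by (simp add: vec_eq_iff upper_part_def lower_part_def matrix_vector_mult_def sum_UNIV_Plus dirac_coeff_entry
      if_distrib[of "\<lambda>x. x * _"] sum_distrib_left mult.assoc cong: if_cong)

lemma dirac_coeff_lower:
  "lower_part (dirac_coeff v z x *v f) = (- \<i> * z) *s lower_part f + (- \<i>) *s (adjoint_mat (v x) *v upper_part f)"
  by (simp add: vec_eq_iff upper_part_def lower_part_def matrix_vector_mult_def sum_UNIV_Plus dirac_coeff_entry adjoint_mat_def
      if_distrib[of "\<lambda>x. x * _"] sum_distrib_left sum_negf mult.assoc cong: if_cong)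

definition dirac_solution ::
  "(real \<Rightarrow> complex^'b^'a) \<Rightarrow> complex \<Rightarrow> (real \<Rightarrow> complex^('a::finite + 'b::finite)) \<Rightarrow> bool" where
  "dirac_solution v z f \<longleftrightarrow>
     (\<forall>x\<ge>0. (f has_vector_derivative dirac_coeff v z x *v f x) (at x within {0..}))"

lemma dirac_solution_upper:
  assumes "dirac_solution v z f" "x \<ge> 0"
  shows "((\<lambda>x. upper_part (f x)) has_vector_derivative (\<i> * z) *s upper_part (f x) + \<i> *s (v x *v lower_part (f x)))
    (at x within {0..})"
  using bounded_linear.has_vector_derivative[OF bounded_linear_upper, of f] assms
  unfolding dirac_solution_def dirac_coeff_upper[symmetric] by blast

lemma dirac_solution_lower:
  assumes "dirac_solution v z f" "x \<ge> 0"
  shows "((\<lambda>x. lower_part (f x)) has_vector_derivative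
    (- \<i> * z) *s lower_part (f x) + (- \<i>) *s (adjoint_mat (v x) *v upper_part (f x))) (at x within {0..})"
  using bounded_linear.has_vector_derivative[OF bounded_linear_lower, of f] assms
  unfolding dirac_solution_def dirac_coeff_lower[symmetric] by blast

lemma has_real_derivative_norm_square:
  fixes g :: "real \<Rightarrow> complex^'n::finite"
  assumes "(g has_vector_derivative g') (at x within S)"
  shows "((\<lambda>x. (norm (g x))\<^sup>2) has_real_derivative 2 * Re (herm (g x) g')) (at x within S)"
proof -
  have "((\<lambda>x. Re (herm (g x) (g x))) has_vector_derivative Re (herm (g x) g' + herm g' (g x))) (at x within S)"
    by (intro bounded_linear.has_vector_derivative[OF bounded_linear_Re]
        bounded_bilinear.has_vector_derivative[OF bounded_bilinear_herm] assms)
  moreover have "Re (herm (g x) g' + herm g' (g x)) = 2 * Re (herm (g x) g')"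
    by (subst (2) herm_commute) simp
  ultimately show ?thesis
    by (simp add: herm_same has_real_derivative_iff_has_vector_derivative)
qed

text \<open>The couplings through v and its adjoint contribute the same real number X to both
  derivatives. It therefore cancels in the difference of the two energies, whose sign of change is
  then governed by Im z alone, while in the sum or in a single energy it is controlled by the norm
  of v.\<close>

lemma dirac_energy:
  assumes "dirac_solution v z f" "x \<ge> 0"
  obtains X where "\<bar>X\<bar> \<le> norm (v x) * (norm (upper_part (f x)) * norm (lower_part (f x)))"
    and "((\<lambda>x. (norm (upper_part (f x)))\<^sup>2) has_real_derivative
           2 * X - 2 * Im z * (norm (upper_part (f x)))\<^sup>2) (at x within {0..})"
    and "((\<lambda>x. (norm (lower_part (f x)))\<^sup>2) has_real_derivative
           2 * X + 2 * Im z * (norm (lower_part (f x)))\<^sup>2) (at x within {0..})"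
proof
  let ?X = "Re (\<i> * herm (upper_part (f x)) (v x *v lower_part (f x)))"
  have "\<bar>?X\<bar> \<le> cmod (\<i> * herm (upper_part (f x)) (v x *v lower_part (f x)))" by (rule abs_Re_le_cmod)
  also have "\<dots> \<le> norm (upper_part (f x)) * norm (v x *v lower_part (f x))"
    by (simp add: norm_mult cmod_herm_le)
  also have "\<dots> \<le> norm (upper_part (f x)) * (norm (v x) * norm (lower_part (f x)))"
    by (intro mult_left_mono norm_matrix_vector_mult_le) auto
  finally show "\<bar>?X\<bar> \<le> norm (v x) * (norm (upper_part (f x)) * norm (lower_part (f x)))"
    by (simp add: mult_ac)
  show "((\<lambda>x. (norm (upper_part (f x)))\<^sup>2) has_real_derivative
           2 * ?X - 2 * Im z * (norm (upper_part (f x)))\<^sup>2) (at x within {0..})"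
    using has_real_derivative_norm_square[OF dirac_solution_upper[OF assms]]
    by (simp add: herm_simps herm_same algebra_simps)
  have "herm (upper_part (f x)) (v x *v lower_part (f x)) = cnj (herm (lower_part (f x)) (adjoint_mat (v x) *v upper_part (f x)))"
    by (subst herm_commute) (simp add: herm_adjoint_mat)
  then show "((\<lambda>x. (norm (lower_part (f x)))\<^sup>2) has_real_derivative
           2 * ?X + 2 * Im z * (norm (lower_part (f x)))\<^sup>2) (at x within {0..})"
    using has_real_derivative_norm_square[OF dirac_solution_lower[OF assms]]
    by (simp only: herm_simps herm_same) (simp add: algebra_simps)
qed

section \<open>Gronwall estimates for solutions\<close>

lemma nonincreasing_on_halfline:
  fixes g :: "real \<Rightarrow> real"
  assumes "\<And>t. t \<ge> 0 \<Longrightarrow> t \<le> y \<Longrightarrow> \<exists>d. (g has_real_derivative d) (at t within {0..}) \<and> d \<le> 0"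
    and "0 \<le> x" "x \<le> y"
  shows "g y \<le> g x"
proof (rule DERIV_nonpos_imp_decreasing_open[where f = g])
  show "\<exists>d. (g has_real_derivative d) (at t) \<and> d \<le> 0" if "x < t" "t < y" for t
  proof -
    have "t \<in> interior {0..}" using that assms by (simp add: interior_Ici[of "-1"])
    then show ?thesis using assms(1)[of t] that assms(2) at_within_interior by fastforce
  qed
  have "continuous_on {0..y} g"
    unfolding continuous_on_eq_continuous_within
  proof
    fix t assume "t \<in> {0..y}"
    then have "continuous (at t within {0..}) g" using assms(1) DERIV_continuous by fastforce
    then show "continuous (at t within {0..y}) g"
      by (rule continuous_within_subset) auto
  qed
  then show "continuous_on {x..y} g" by (rule continuous_on_subset) (use assms in auto)
qed fact

text \<open>The product of g with exp(-k t) is nonincreasing. The sign of k is free, so decay is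
  covered as well as growth.\<close>

lemma gronwall_halfline:
  fixes g :: "real \<Rightarrow> real"
  assumes "\<And>t. t \<ge> 0 \<Longrightarrow> t \<le> X \<Longrightarrow> \<exists>d. (g has_real_derivative d) (at t within {0..}) \<and> d \<le> k * g t"
    and "0 \<le> X"
  shows "g X \<le> g 0 * exp (k * X)"
proof -
  have "g X * exp (- k * X) \<le> g 0 * exp (- k * 0)"
  proof (rule nonincreasing_on_halfline[where g = "\<lambda>t. g t * exp (- k * t)"])
    fix t assume "0 \<le> t" "t \<le> X"
    then obtain d where d: "(g has_real_derivative d) (at t within {0..})" "d \<le> k * g t"
      using assms by blast
    have "((\<lambda>t. g t * exp (- k * t)) has_real_derivative (d - k * g t) * exp (- k * t)) (at t within {0..})"
      by (rule derivative_eq_intros d refl | simp add: algebra_simps)+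
    moreover have "(d - k * g t) * exp (- k * t) \<le> 0"
      using d by (simp add: mult_le_0_iff)
    ultimately show "\<exists>d. ((\<lambda>t. g t * exp (- k * t)) has_real_derivative d) (at t within {0..}) \<and> d \<le> 0"
      by blast
  qed (use assms in auto)
  then have "g X * exp (- k * X) * exp (k * X) \<le> g 0 * exp (k * X)" by (intro mult_right_mono) auto
  then show ?thesis by (simp add: mult.assoc flip: exp_add)
qed

text \<open>The hypothesis concerns the squared norm because the norm itself need not be
  differentiable where g vanishes.\<close>

lemma norm_gronwall:
  fixes g :: "real \<Rightarrow> 'e::real_normed_vector"
  assumes "\<And>t. t \<ge> 0 \<Longrightarrow> t \<le> X \<Longrightarrow>
      \<exists>d. ((\<lambda>t. (norm (g t))\<^sup>2) has_real_derivative d) (at t within {0..}) \<and> d \<le> 2 * k * (norm (g t))\<^sup>2"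
    and "0 \<le> X"
  shows "norm (g X) \<le> norm (g 0) * exp (k * X)"
proof (rule power2_le_imp_le)
  have "(norm (g X))\<^sup>2 \<le> (norm (g 0))\<^sup>2 * exp (2 * k * X)"
    using assms by (rule gronwall_halfline)
  then show "(norm (g X))\<^sup>2 \<le> (norm (g 0) * exp (k * X))\<^sup>2"
    by (simp add: power_mult_distrib mult.assoc flip: exp_double)
qed simp

text \<open>In the sum of the two energies the coupling is absorbed by 2 |f1| |f2| <= |f1|^2 +
  |f2|^2. The rate sees z only through |Im z|, whence boundedness in real z.\<close>

lemma dirac_solution_growth:
  assumes f: "dirac_solution v z f" and X: "0 \<le> X" and K: "\<And>t. t \<in> {0..X} \<Longrightarrow> norm (v t) \<le> K"
  shows "norm (f X) \<le> norm (f 0) * exp ((K + \<bar>Im z\<bar>) * X)"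
proof (rule norm_gronwall[OF _ X])
  fix t assume t: "0 \<le> t" "t \<le> X"
  let ?u = "norm (upper_part (f t))" and ?l = "norm (lower_part (f t))"
  from dirac_energy[OF f t(1)] obtain Y where
    Y: "\<bar>Y\<bar> \<le> norm (v t) * (?u * ?l)"
    "((\<lambda>x. (norm (upper_part (f x)))\<^sup>2) has_real_derivative 2 * Y - 2 * Im z * ?u\<^sup>2) (at t within {0..})"
    "((\<lambda>x. (norm (lower_part (f x)))\<^sup>2) has_real_derivative 2 * Y + 2 * Im z * ?l\<^sup>2) (at t within {0..})" .
  have "((\<lambda>x. (norm (f x))\<^sup>2) has_real_derivative
     (2 * Y - 2 * Im z * ?u\<^sup>2) + (2 * Y + 2 * Im z * ?l\<^sup>2)) (at t within {0..})"
    unfolding power2_norm_upper_lower by (intro DERIV_add Y)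
  moreover have "(2 * Y - 2 * Im z * ?u\<^sup>2) + (2 * Y + 2 * Im z * ?l\<^sup>2) \<le> 2 * (K + \<bar>Im z\<bar>) * (norm (f t))\<^sup>2"
  proof -
    have "K \<ge> 0" using K[of t] t by (auto intro: order_trans[OF norm_ge_zero])
    have "\<bar>Y\<bar> \<le> K * (?u * ?l)"
      by (rule order_trans[OF Y(1)]) (use K t in \<open>auto intro!: mult_right_mono\<close>)
    moreover have "K * (2 * (?u * ?l)) \<le> K * (?u\<^sup>2 + ?l\<^sup>2)"
      using \<open>K \<ge> 0\<close> sum_squares_bound[of ?u ?l] by (intro mult_left_mono) (auto simp: mult_ac)
    moreover have "- (Im z * ?u\<^sup>2) \<le> \<bar>Im z\<bar> * ?u\<^sup>2" "Im z * ?l\<^sup>2 \<le> \<bar>Im z\<bar> * ?l\<^sup>2"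
      using mult_right_mono[of "- Im z" "\<bar>Im z\<bar>" "?u\<^sup>2"] mult_right_mono[of "Im z" "\<bar>Im z\<bar>" "?l\<^sup>2"]
      by auto
    ultimately show ?thesis by (simp add: power2_norm_upper_lower algebra_simps)
  qed
  ultimately show "\<exists>d. ((\<lambda>x. (norm (f x))\<^sup>2) has_real_derivative d) (at t within {0..}) \<and>
    d \<le> 2 * (K + \<bar>Im z\<bar>) * (norm (f t))\<^sup>2" by blast
qed

text \<open>When the lower part is dominated, the coupling is at most K times the upper energy, so
  the rate keeps its sign -Im z up to K. This yields the decay of Weyl solutions.\<close>

lemma dirac_solution_upper_bound:
  assumes f: "dirac_solution v z f" and X: "0 \<le> X" and K: "\<And>t. t \<in> {0..X} \<Longrightarrow> norm (v t) \<le> K"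
    and dom: "\<And>t. t \<in> {0..X} \<Longrightarrow> norm (lower_part (f t)) \<le> norm (upper_part (f t))"
  shows "norm (upper_part (f X)) \<le> norm (upper_part (f 0)) * exp ((K - Im z) * X)"
proof (rule norm_gronwall[OF _ X])
  fix t assume t: "0 \<le> t" "t \<le> X"
  let ?u = "norm (upper_part (f t))" and ?l = "norm (lower_part (f t))"
  from dirac_energy[OF f t(1)] obtain Y where
    Y: "\<bar>Y\<bar> \<le> norm (v t) * (?u * ?l)"
    "((\<lambda>x. (norm (upper_part (f x)))\<^sup>2) has_real_derivative 2 * Y - 2 * Im z * ?u\<^sup>2) (at t within {0..})" .
  have "norm (v t) * (?u * ?l) \<le> K * (?u * ?u)"
    using K dom t order_trans[OF norm_ge_zero K[of t]] by (intro mult_mono) auto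
  then have "2 * Y - 2 * Im z * ?u\<^sup>2 \<le> 2 * (K - Im z) * ?u\<^sup>2"
    using Y(1) by (simp add: algebra_simps power2_eq_square)
  then show "\<exists>d. ((\<lambda>x. (norm (upper_part (f x)))\<^sup>2) has_real_derivative d) (at t within {0..}) \<and>
    d \<le> 2 * (K - Im z) * ?u\<^sup>2" using Y(2) by blast
qed

text \<open>The mirror image, meant for solutions at \<open>cnj z\<close> with Im z > 0: there the
  rate is K - Im z, which again means decay.\<close>

lemma dirac_solution_lower_bound:
  assumes f: "dirac_solution v z f" and X: "0 \<le> X" and K: "\<And>t. t \<in> {0..X} \<Longrightarrow> norm (v t) \<le> K"
    and dom: "\<And>t. t \<in> {0..X} \<Longrightarrow> norm (upper_part (f t)) \<le> norm (lower_part (f t))"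
  shows "norm (lower_part (f X)) \<le> norm (lower_part (f 0)) * exp ((K + Im z) * X)"
proof (rule norm_gronwall[OF _ X])
  fix t assume t: "0 \<le> t" "t \<le> X"
  let ?u = "norm (upper_part (f t))" and ?l = "norm (lower_part (f t))"
  from dirac_energy[OF f t(1)] obtain Y where
    Y: "\<bar>Y\<bar> \<le> norm (v t) * (?u * ?l)"
    "((\<lambda>x. (norm (lower_part (f x)))\<^sup>2) has_real_derivative 2 * Y + 2 * Im z * ?l\<^sup>2) (at t within {0..})" .
  have "norm (v t) * (?u * ?l) \<le> K * (?l * ?l)"
    using K dom t order_trans[OF norm_ge_zero K[of t]] by (intro mult_mono) auto
  then have "2 * Y + 2 * Im z * ?l\<^sup>2 \<le> 2 * (K + Im z) * ?l\<^sup>2"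
    using Y(1) by (simp add: algebra_simps power2_eq_square)
  then show "\<exists>d. ((\<lambda>x. (norm (lower_part (f x)))\<^sup>2) has_real_derivative d) (at t within {0..}) \<and>
    d \<le> 2 * (K + Im z) * ?l\<^sup>2" using Y(2) by blast
qed

section \<open>From square integrability to a pointwise inequality\<close>

lemma emeasure_lborel_Ioi: "emeasure lborel {a::real<..} = \<infinity>"
proof (rule ccontr)
  assume "emeasure lborel {a::real<..} \<noteq> \<infinity>"
  then obtain r where r: "emeasure lborel {a::real<..} = ennreal r" "0 \<le> r"
    by (cases "emeasure lborel {a::real<..}" rule: ennreal_cases) auto
  have "ennreal (r + 1) = emeasure lborel {a<..a + (r + 1)}" using r by simp
  also have "\<dots> \<le> emeasure lborel {a<..}" by (rule emeasure_mono) auto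
  finally show False using r by simp
qed

text \<open>The energy |f1|^2 - |f2|^2 is nonincreasing for Im z > 0. Once it equals -\<delta> < 0,
  the squared norm of f stays above \<delta> forever, contradicting integrability. The majorant G
  allows integrability to be supplied by the entries of a matrix of which f is a
  combination.\<close>

lemma square_integrable_imp_lower_le_upper:
  assumes f: "dirac_solution v z f" and z: "Im z > 0" and x: "x \<ge> 0"
    and G: "set_integrable lborel {0<..} G" "\<And>x. x > 0 \<Longrightarrow> (norm (f x))\<^sup>2 \<le> G x"
  shows "norm (lower_part (f x)) \<le> norm (upper_part (f x))"
proof (rule ccontr)
  define E where "E = (\<lambda>t. (norm (upper_part (f t)))\<^sup>2 - (norm (lower_part (f t)))\<^sup>2)"
  define \<delta> where "\<delta> = - E x"
  assume "\<not> norm (lower_part (f x)) \<le> norm (upper_part (f x))"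
  then have \<delta>: "\<delta> > 0" by (simp add: \<delta>_def E_def power_strict_mono)
  have "\<delta> \<le> G t" if t: "t > x" for t
  proof -
    have "E t \<le> E x"
    proof (rule nonincreasing_on_halfline[where g = E])
      fix s :: real assume s: "0 \<le> s"
      let ?u = "norm (upper_part (f s))" and ?l = "norm (lower_part (f s))"
      from dirac_energy[OF f s] obtain Y where
        Y: "((\<lambda>x. (norm (upper_part (f x)))\<^sup>2) has_real_derivative 2 * Y - 2 * Im z * ?u\<^sup>2) (at s within {0..})"
          "((\<lambda>x. (norm (lower_part (f x)))\<^sup>2) has_real_derivative 2 * Y + 2 * Im z * ?l\<^sup>2) (at s within {0..})" .
      have "(2 * Y - 2 * Im z * ?u\<^sup>2) - (2 * Y + 2 * Im z * ?l\<^sup>2) = - (2 * Im z * (?u\<^sup>2 + ?l\<^sup>2))"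
        by (simp add: algebra_simps)
      also have "\<dots> \<le> 0" using z by (simp add: mult_nonneg_nonneg)
      finally show "\<exists>d. (E has_real_derivative d) (at s within {0..}) \<and> d \<le> 0"
        unfolding E_def using DERIV_diff[OF Y] by blast
    qed (use x t in auto)
    then have "\<delta> \<le> (norm (f t))\<^sup>2"
      unfolding power2_norm_upper_lower \<delta>_def E_def
      using zero_le_power2[of "norm (upper_part (f t))"] by linarith
    then show ?thesis using G(2)[of t] t x by simp
  qed
  then have "set_integrable lborel {x<..} (\<lambda>_. \<delta>)"
    using x \<delta>
    by (intro set_integrable_bound[OF set_integrable_subset[OF G(1)]] AE_I2)
       (auto simp: set_borel_measurable_def intro!: order_trans[OF _ abs_ge_self])
  then have "integrable lborel (\<lambda>t. \<delta> * indicator {x<..} t)"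
    by (simp add: set_integrable_def mult.commute)
  then have "integrable lborel (indicator {x<..} :: real \<Rightarrow> real)"
    using \<delta> by simp
  then show False by (simp add: integrable_indicator_iff emeasure_lborel_Ioi)
qed

section \<open>Superposition, uniqueness and entire fundamental solutions\<close>

lemma dirac_solution_add:
  "dirac_solution v z f \<Longrightarrow> dirac_solution v z g \<Longrightarrow> dirac_solution v z (\<lambda>x. f x + g x)"
  unfolding dirac_solution_def matrix_vector_right_distrib by (intro allI impI has_vector_derivative_add) auto

lemma dirac_solution_scale:
  assumes "dirac_solution v z f" shows "dirac_solution v z (\<lambda>x. c *s f x)"
  unfolding dirac_solution_def vector_scalar_commute
  using assms unfolding dirac_solution_def
  by (intro allI impI bounded_linear.has_vector_derivative[OF
        bounded_bilinear.bounded_linear_right[OF bounded_bilinear_vector_scalar_mult]]) auto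

lemma dirac_solution_sum:
  assumes "\<And>i. i \<in> I \<Longrightarrow> dirac_solution v z (f i)" "finite I"
  shows "dirac_solution v z (\<lambda>x. \<Sum>i\<in>I. f i x)"
  using assms(2,1)
proof (induction I rule: finite_induct)
  case empty
  show ?case by (simp add: dirac_solution_def)
next
  case (insert i I)
  then show ?case by (simp add: dirac_solution_add)
qed

lemma dirac_solution_unique:
  assumes v: "continuous_on {0..} v" and f: "dirac_solution v z f" and g: "dirac_solution v z g"
    and "f 0 = g 0" "0 \<le> x"
  shows "f x = g x"
proof -
  obtain K where K: "\<And>t. t \<in> {0..x} \<Longrightarrow> norm (v t) \<le> K"
    using halfline_bounded_on_interval[OF v] by blast
  have "dirac_solution v z (\<lambda>x. f x + (-1) *s g x)"
    by (intro dirac_solution_add dirac_solution_scale f g)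
  from dirac_solution_growth[OF this \<open>0 \<le> x\<close> K] assms(4)
  show ?thesis by (simp add: vec_eq_iff)
qed

lemma fundamental_solution_dirac_solution:
  assumes "fundamental_solution v z U"
  shows "dirac_solution v z (\<lambda>x. U x *v k)"
  unfolding dirac_solution_def matrix_vector_mul_assoc
  using assms unfolding fundamental_solution_def
  by (intro allI impI bounded_linear.has_vector_derivative[OF
        bounded_bilinear.bounded_linear_left[OF bounded_bilinear_matrix_vector_mult]]) auto

text \<open>Unlike \<open>fundamental_solution\<close>, which fixes z, this covers all z at once and
  includes holomorphy. The equation is stated for the vectors \<open>U z x *v k\<close>, the form
  that the energy estimates take.\<close>

definition entire_fundamental ::
  "(real \<Rightarrow> complex^'b^'a) \<Rightarrow> (complex \<Rightarrow> real \<Rightarrow> complex^('a::finite + 'b::finite)^('a + 'b)) \<Rightarrow> bool" where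
  "entire_fundamental v U \<longleftrightarrow> (\<forall>z k. dirac_solution v z (\<lambda>x. U z x *v k)) \<and> (\<forall>z. U z 0 = mat 1) \<and>
     (\<forall>x\<ge>0. \<forall>i j. (\<lambda>z. U z x $ i $ j) holomorphic_on UNIV)"

lemma entire_fundamental_0: "entire_fundamental v U \<Longrightarrow> U z 0 = mat 1"
  and entire_fundamental_solution: "entire_fundamental v U \<Longrightarrow> dirac_solution v z (\<lambda>x. U z x *v k)"
  and entire_fundamental_holomorphic:
    "entire_fundamental v U \<Longrightarrow> 0 \<le> x \<Longrightarrow> (\<lambda>z. U z x $ i $ j) holomorphic_on UNIV"
  by (auto simp: entire_fundamental_def)

text \<open>The parameter enters only through the term i z J, so the Picard construction applies to
  each column with a constant B.\<close>

lemma dirac_entire_fundamental_solution: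
  fixes v :: "real \<Rightarrow> complex^'b::finite^'a::finite"
  assumes v: "continuous_on {0..} v"
  shows "\<exists>U. entire_fundamental v U"
proof -
  define B :: "complex^('a + 'b)^('a + 'b)" where "B = (\<chi> i j. \<i> * dirac_J $ i $ j)"
  have split: "dirac_coeff v z x *v f = dirac_coeff v 0 x *v f + z *s (B *v f)" for z x and f :: "complex^('a+'b)"
    unfolding vec_eq_iff matrix_vector_mult_def dirac_coeff_def B_def vector_add_component
      vector_smult_component vec_lambda_beta sum_distrib_left sum.distrib[symmetric]
    by (intro allI sum.cong refl) (simp add: algebra_simps)
  have "continuous_on {0..} (\<lambda>x. dirac_coeff v 0 x $ i $ j)" for i j
    by (cases i; cases j) (auto simp: dirac_coeff_entry intro!: continuous_intros v)
  then have "continuous_on {0..} (\<lambda>x. \<chi> i j. dirac_coeff v 0 x $ i $ j)"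
    by (intro continuous_on_vec_lambda)
  then have cont: "continuous_on {0..} (dirac_coeff v 0)" by simp
  have "\<exists>u. (\<forall>z. u z 0 = axis j 1) \<and> (\<forall>z. dirac_solution v z (u z)) \<and>
      (\<forall>x\<ge>0. \<forall>i. (\<lambda>z. u z x $ i) holomorphic_on UNIV)" for j
  proof (rule linear_ode_entire_solution[OF cont, of "axis j 1" B])
    fix u assume u: "\<And>z. u z 0 = axis j 1"
      "\<And>z x. 0 \<le> x \<Longrightarrow> (u z has_vector_derivative dirac_coeff v 0 x *v u z x + z *s (B *v u z x)) (at x within {0..})"
      "\<And>x i. 0 \<le> x \<Longrightarrow> (\<lambda>z. u z x $ i) holomorphic_on UNIV"
    have "dirac_solution v z (u z)" for z
      unfolding dirac_solution_def
    proof (intro allI impI)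
      fix x :: real assume "0 \<le> x"
      then show "(u z has_vector_derivative dirac_coeff v z x *v u z x) (at x within {0..})"
        unfolding split[of z x "u z x"] by (rule u)
    qed
    then show ?thesis using u by blast
  qed
  then obtain u where u: "\<And>j z. u j z 0 = axis j 1" "\<And>j z. dirac_solution v z (u j z)"
     "\<And>j x i. x \<ge> 0 \<Longrightarrow> (\<lambda>z. u j z x $ i) holomorphic_on UNIV"
    by metis
  define U where "U z x = (\<chi> i j. u j z x $ i)" for z x
  have "dirac_solution v z (\<lambda>x. U z x *v k)" for z k
  proof -
    have "U z x *v k = (\<Sum>j\<in>UNIV. k $ j *s u j z x)" for x
      by (simp add: matrix_mult_sum column_def U_def)
    then show ?thesis
      by (simp only:) (intro dirac_solution_sum dirac_solution_scale u; simp)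
  qed
  moreover have "U z 0 = mat 1" for z
    by (auto simp: U_def u mat_def axis_def vec_eq_iff)
  moreover have "(\<lambda>z. U z x $ i $ j) holomorphic_on UNIV" if "0 \<le> x" for x i j
    using u(3)[OF that] by (simp add: U_def)
  ultimately show ?thesis unfolding entire_fundamental_def by blast
qed

section \<open>Weyl solutions at z and their duals at conj z\<close>

lemma block_col_mult: "block_col P *v h = vjoin h (P *v h)"
  by (auto simp: block_col_def vjoin_def vec_eq_iff matrix_vector_mult_def
      if_distrib[of "\<lambda>x. x * _"] cong: if_cong split: sum.split)

lemma power2_norm_matrix:
  "(norm (A::complex^'n::finite^'m::finite))\<^sup>2 = (\<Sum>i\<in>UNIV. \<Sum>j\<in>UNIV. (cmod (A $ i $ j))\<^sup>2)"
proof -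
  have "(norm A)\<^sup>2 = (\<Sum>i\<in>UNIV. (norm (A $ i))\<^sup>2)"
    by (simp add: norm_vec_def[of A] L2_set_def sum_nonneg)
  then show ?thesis by (simp add: power2_norm_vec)
qed

text \<open>By uniqueness f is the square integrable block of the definition applied to h, and its
  squared norm is at most the sum of the squared entries times |h|^2. Here the L2 condition becomes
  the inequality on which the later estimates rest.\<close>

lemma weyl_solution_lower_le_upper:
  assumes v: "continuous_on {0..} v" and \<phi>: "weyl_function v \<phi>" and z: "Im z > 0"
    and f: "dirac_solution v z f" "f 0 = vjoin h (\<phi> z *v h)" and x: "x \<ge> 0"
  shows "norm (lower_part (f x)) \<le> norm (upper_part (f x))"
proof -
  obtain U where U: "fundamental_solution v z U"
    "\<And>i j. square_integrable_halfline (\<lambda>x. (U x ** block_col (\<phi> z)) $ i $ j)"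
    using \<phi> z unfolding weyl_function_def by blast
  define Y where "Y = (\<lambda>x. U x ** block_col (\<phi> z))"
  have fY: "f x = Y x *v h" if "x \<ge> 0" for x
  proof -
    have "U 0 = mat 1" using U(1) by (simp add: fundamental_solution_def)
    have "f x = U x *v vjoin h (\<phi> z *v h)"
      by (rule dirac_solution_unique[OF v f(1) fundamental_solution_dirac_solution[OF U(1)]])
         (use \<open>U 0 = mat 1\<close> f(2) that in simp_all)
    then show ?thesis by (simp add: Y_def block_col_mult flip: matrix_vector_mul_assoc)
  qed
  show ?thesis
  proof (rule square_integrable_imp_lower_le_upper[OF f(1) z x])
    have "set_integrable lborel {0<..} (\<lambda>x. (cmod (Y x $ i $ j))\<^sup>2)" for i j
      using U(2) unfolding square_integrable_halfline_def Y_def by blast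
    then have "integrable lborel (\<lambda>x. (\<Sum>i\<in>UNIV. \<Sum>j\<in>UNIV.
        indicator {0<..} x *\<^sub>R (cmod (Y x $ i $ j))\<^sup>2) * (norm h)\<^sup>2)"
      unfolding set_integrable_def
      by (intro integrable_mult_left Bochner_Integration.integrable_sum)
    then show "set_integrable lborel {0<..} (\<lambda>x. (\<Sum>i\<in>UNIV. \<Sum>j\<in>UNIV. (cmod (Y x $ i $ j))\<^sup>2) * (norm h)\<^sup>2)"
      by (simp only: set_integrable_def scaleR_sum_right[symmetric] mult_scaleR_left)
    show "(norm (f x))\<^sup>2 \<le> (\<Sum>i\<in>UNIV. \<Sum>j\<in>UNIV. (cmod (Y x $ i $ j))\<^sup>2) * (norm h)\<^sup>2" if "x > 0" for x
    proof -
      have "norm (f x) \<le> norm (Y x) * norm h" using that by (simp add: fY norm_matrix_vector_mult_le)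
      then have "(norm (f x))\<^sup>2 \<le> (norm (Y x) * norm h)\<^sup>2" by (intro power_mono) auto
      then show ?thesis by (simp add: power_mult_distrib power2_norm_matrix)
    qed
  qed
qed

text \<open>With A(z) the coefficient matrix, A(conj z)^* J + J A(z) = 0, so the derivative of g^* J
  f vanishes.\<close>

lemma dirac_form_conserved:
  assumes f: "dirac_solution v z f" and g: "dirac_solution v (cnj z) g" and x: "x \<ge> 0"
  shows "herm (upper_part (g x)) (upper_part (f x)) - herm (lower_part (g x)) (lower_part (f x)) =
         herm (upper_part (g 0)) (upper_part (f 0)) - herm (lower_part (g 0)) (lower_part (f 0))"
proof -
  let ?Q = "\<lambda>x. herm (upper_part (g x)) (upper_part (f x)) - herm (lower_part (g x)) (lower_part (f x))"
  have der: "(?Q has_vector_derivative 0) (at t within {0..})" if "t \<in> {0..}" for t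
  proof -
    have t: "t \<ge> 0" using that by simp
    have "herm (v t *v lower_part (g t)) (upper_part (f t)) = herm (lower_part (g t)) (adjoint_mat (v t) *v upper_part (f t))"
      by (simp add: herm_adjoint_mat[where A = "adjoint_mat (v t)"])
    moreover have "herm (upper_part (g t)) (v t *v lower_part (f t)) = herm (adjoint_mat (v t) *v upper_part (g t)) (lower_part (f t))"
      by (rule herm_adjoint_mat)
    ultimately show ?thesis
      using has_vector_derivative_diff[OF
        bounded_bilinear.has_vector_derivative[OF bounded_bilinear_herm
          dirac_solution_upper[OF g t] dirac_solution_upper[OF f t]]
        bounded_bilinear.has_vector_derivative[OF bounded_bilinear_herm
          dirac_solution_lower[OF g t] dirac_solution_lower[OF f t]]]
      by (simp only: herm_simps) (simp add: algebra_simps)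
  qed
  obtain c where "\<And>t. t \<in> {0..} \<Longrightarrow> ?Q t = c"
    by (rule has_vector_derivative_zero_constant[OF convex_real_interval(1)[of 0] der]) auto
  then show ?thesis using x by simp
qed

text \<open>g is J-orthogonal to the Weyl plane, a maximal J-nonnegative subspace, hence J-nonpositive.\<close>

lemma adjoint_weyl_solution_upper_le_lower:
  assumes v: "continuous_on {0..} v" and \<phi>: "weyl_function v \<phi>" and z: "Im z > 0"
    and g: "dirac_solution v (cnj z) g" "g 0 = vjoin (adjoint_mat (\<phi> z) *v k) k" and x: "x \<ge> 0"
  shows "norm (upper_part (g x)) \<le> norm (lower_part (g x))"
proof -
  obtain U where "entire_fundamental v U"
    using dirac_entire_fundamental_solution[OF v] by blast
  note U = entire_fundamental_solution[OF this] entire_fundamental_0[OF this]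
  define f where "f h x = U z x *v vjoin h (\<phi> z *v h)" for h x
  have f: "dirac_solution v z (f h)" "f h 0 = vjoin h (\<phi> z *v h)" for h
    unfolding f_def[abs_def] by (auto simp: U)
  note dom = weyl_solution_lower_le_upper[OF v \<phi> z f x]
  \<comment> \<open>Real linearity is enough: an injective real-linear endomorphism of a
    finite-dimensional space is surjective.\<close>
  have lin: "linear (\<lambda>h. upper_part (f h x))"
  proof -
    have "f (h + h') x = f h x + f h' x" "f (c *\<^sub>R h) x = c *\<^sub>R f h x" for h h' c
    proof -
      have "vjoin (h + h') (\<phi> z *v (h + h')) = vjoin h (\<phi> z *v h) + vjoin h' (\<phi> z *v h')"
        by (simp add: vjoin_add matrix_vector_right_distrib)
      then show "f (h + h') x = f h x + f h' x" by (simp add: f_def matrix_vector_right_distrib)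
      have "vjoin (c *\<^sub>R h) (\<phi> z *v (c *\<^sub>R h)) = c *\<^sub>R vjoin h (\<phi> z *v h)"
        by (auto simp: vec_eq_iff vjoin_def bounded_bilinear.scaleR_right[OF bounded_bilinear_matrix_vector_mult]
            split: sum.split)
      then show "f (c *\<^sub>R h) x = c *\<^sub>R f h x"
        by (simp add: f_def bounded_bilinear.scaleR_right[OF bounded_bilinear_matrix_vector_mult])
    qed
    then show ?thesis
      by (intro linearI)
        (auto simp: linear_add[OF bounded_linear.linear[OF bounded_linear_upper]]
           linear_scale[OF bounded_linear.linear[OF bounded_linear_upper]])
  qed
  \<comment> \<open>If the upper part vanishes at x, so does all of \<open>f h x\<close>. Pairing
    with the solution at \<open>cnj z\<close> that starts at (h, 0) then gives |h|^2 = 0 by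
    conservation.\<close>
  have "inj (\<lambda>h. upper_part (f h x))"
    unfolding linear_injective_0[OF lin]
  proof (intro allI impI)
    fix h assume "upper_part (f h x) = 0"
    moreover from this have "lower_part (f h x) = 0" using dom[of h] by simp
    ultimately have "herm h h = 0"
      using dirac_form_conserved[OF f(1)[of h] U(1)[of "cnj z" "vjoin h 0"] x]
      by (simp add: U(2) f(2) herm_simps)
    then show "h = 0" by (simp add: herm_same)
  qed
  then have "surj (\<lambda>h. upper_part (f h x))" by (rule linear_injective_imp_surjective[OF lin]) simp
  \<comment> \<open>Choose the Weyl solution sharing its upper part with g at x. The conserved form
    is 0, so |g1|^2 = <g2, f2> with |f2| <= |f1| = |g1|.\<close>
  from surjD[OF this, of "upper_part (g x)"] obtain h where h: "upper_part (f h x) = upper_part (g x)" by auto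
  have "herm (adjoint_mat (\<phi> z) *v k) h = herm k (\<phi> z *v h)" by (simp add: herm_adjoint_mat)
  then have "herm (upper_part (g x)) (upper_part (f h x)) = herm (lower_part (g x)) (lower_part (f h x))"
    using dirac_form_conserved[OF f(1)[of h] g(1) x] by (simp add: f(2) g(2))
  then have "of_real ((norm (upper_part (g x)))\<^sup>2) = herm (lower_part (g x)) (lower_part (f h x))"
    unfolding h herm_same .
  then have "cmod (of_real ((norm (upper_part (g x)))\<^sup>2)) = cmod (herm (lower_part (g x)) (lower_part (f h x)))"
    by (rule arg_cong)
  then have "(norm (upper_part (g x)))\<^sup>2 = cmod (herm (lower_part (g x)) (lower_part (f h x)))"
    unfolding norm_of_real by (simp only: abs_power2)
  also have "\<dots> \<le> norm (lower_part (g x)) * norm (lower_part (f h x))" by (rule cmod_herm_le)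
  also have "\<dots> \<le> norm (lower_part (g x)) * norm (upper_part (g x))"
    using dom[of h] h by (intro mult_left_mono) auto
  finally have "norm (upper_part (g x)) * norm (upper_part (g x)) \<le> norm (lower_part (g x)) * norm (upper_part (g x))"
    by (simp only: power2_eq_square)
  then show ?thesis
    using mult_right_le_imp_le norm_ge_zero by (metis order_le_less)
qed

section \<open>The transfer matrix between two systems\<close>

text \<open>The diagonal of J: conjugation by J multiplies entry (k, j) by
  \<open>dirac_sign k * dirac_sign j\<close>.\<close>

definition dirac_sign :: "'a::finite + 'b::finite \<Rightarrow> complex" where
  "dirac_sign i = (case i of Inl _ \<Rightarrow> 1 | Inr _ \<Rightarrow> - 1)"

text \<open>This is W(x,z) U(x,z)^{-1}, since conservation of the J-form gives U(x,z)^{-1} = J U(x,conj z)^* J.\<close>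

definition transfer where
  "transfer W U x z = (\<chi> i j. \<Sum>k\<in>UNIV. W z x $ i $ k * (dirac_sign k * dirac_sign j * cnj (U (cnj z) x $ j $ k)))"

lemma dirac_sign_simps [simp]: "cmod (dirac_sign i) = 1" "cnj (dirac_sign i) = dirac_sign i" "dirac_sign i * dirac_sign i = 1" "dirac_sign (Inl a) = 1" "dirac_sign (Inr b) = -1"
  by (auto simp: dirac_sign_def split: sum.split)

lemma entire_fundamental_growth:
  assumes U: "entire_fundamental v U" and x: "0 \<le> x" and K: "\<And>t. t \<in> {0..x} \<Longrightarrow> norm (v t) \<le> K"
  shows "norm (U z x *v k) \<le> norm k * exp ((K + \<bar>Im z\<bar>) * x)"
  using dirac_solution_growth[OF entire_fundamental_solution[OF U] x K]
  by (simp add: entire_fundamental_0[OF U])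

lemma matrix_vector_mult_axis_nth: "((A::complex^'n::finite^'m::finite) *v axis j 1) $ i = A $ i $ j"
  by (simp add: matrix_vector_mult_def axis_def if_distrib[of "\<lambda>x. _ * x"] cong: if_cong)

lemma norm_axis_one: "norm (axis j 1 :: complex^'n::finite) = 1"
proof -
  have "(norm (axis j 1 :: complex^'n))\<^sup>2 = 1"
    by (simp add: power2_norm_vec axis_def if_distrib[of cmod] if_distrib[of "\<lambda>x. x\<^sup>2"] cong: if_cong)
  then show ?thesis by (simp add: power2_eq_1_iff)
qed

lemma entire_fundamental_entry_bound:
  assumes U: "entire_fundamental v U" and x: "0 \<le> x" and K: "\<And>t. t \<in> {0..x} \<Longrightarrow> norm (v t) \<le> K"
  shows "cmod (U z x $ i $ j) \<le> exp ((K + \<bar>Im z\<bar>) * x)"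
proof -
  have "cmod (U z x $ i $ j) = cmod ((U z x *v axis j 1) $ i)"
    by (simp add: matrix_vector_mult_axis_nth)
  also have "\<dots> \<le> norm (U z x *v axis j 1)" by (rule Finite_Cartesian_Product.norm_nth_le)
  also have "\<dots> \<le> exp ((K + \<bar>Im z\<bar>) * x)"
    using entire_fundamental_growth[OF U x K, where k = "axis j 1"] by (simp add: norm_axis_one)
  finally show ?thesis .
qed

lemma entire_fundamental_entry_derivative:
  assumes U: "entire_fundamental v U" and x: "0 \<le> x"
  shows "((\<lambda>x. U z x $ i $ j) has_vector_derivative
     (\<Sum>l\<in>UNIV. dirac_coeff v z x $ i $ l * U z x $ l $ j)) (at x within {0..})"
proof -
  have "((\<lambda>x. (U z x *v axis j 1) $ i) has_vector_derivative
      (dirac_coeff v z x *v (U z x *v axis j 1)) $ i) (at x within {0..})"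
    using entire_fundamental_solution[OF U, of z "axis j 1"] x unfolding dirac_solution_def
    by (intro bounded_linear.has_vector_derivative[OF bounded_linear_vec_nth]) auto
  then show ?thesis
    unfolding matrix_vector_mult_axis_nth unfolding matrix_vector_mult_def[of "dirac_coeff v z x"]
    by (simp add: matrix_vector_mult_axis_nth)
qed

text \<open>Conjugating both the argument and the value preserves holomorphy, so the formula for the
  inverse avoids determinants.\<close>

lemma transfer_holomorphic:
  assumes "entire_fundamental w W" "entire_fundamental v U" "0 \<le> x"
  shows "(\<lambda>z. transfer W U x z $ i $ j) holomorphic_on UNIV"
proof -
  have "(\<lambda>z. cnj (U (cnj z) x $ j $ k)) holomorphic_on UNIV" for k
  proof -
    have "(\<lambda>z. U z x $ j $ k) holomorphic_on cnj ` UNIV"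
      by (rule holomorphic_on_subset[OF entire_fundamental_holomorphic[OF assms(2,3)]]) auto
    from holomorphic_on_compose_cnj_cnj[OF this open_UNIV] show ?thesis by (simp add: o_def)
  qed
  then show ?thesis
    unfolding transfer_def
    by (simp, intro holomorphic_intros entire_fundamental_holomorphic[OF assms(1,3)])
qed

lemma transfer_0:
  assumes "entire_fundamental w W" "entire_fundamental v U"
  shows "transfer W U 0 z = mat 1"
  by (auto simp: transfer_def entire_fundamental_0[OF assms(1)] entire_fundamental_0[OF assms(2)]
      vec_eq_iff mat_def if_distrib[of "\<lambda>x. x * _"] if_distrib[of cnj] if_distrib[of "\<lambda>x. _ * x"] cong: if_cong)

text \<open>The inverse of the transfer matrix is the one with the roles of the systems exchanged.\<close>

lemma transfer_swap:
  fixes i j :: "'a::finite + 'b::finite"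
  shows "transfer U W x z $ i $ j = dirac_sign i * dirac_sign j * cnj (transfer W U x (cnj z) $ j $ i)"
proof -
  have dirac_sign2: "dirac_sign i * (dirac_sign i * c) = c" for c by (simp flip: mult.assoc)
  show ?thesis
    by (simp add: transfer_def sum_distrib_left mult_ac dirac_sign2)
qed

text \<open>Used twice: at real z it bounds the matrix independently of z, and in general it gives
  exponential type.\<close>

lemma transfer_growth:
  fixes W U :: "complex \<Rightarrow> real \<Rightarrow> complex^('a::finite + 'b::finite)^('a + 'b)"
  assumes W: "entire_fundamental w W" and U: "entire_fundamental v U" and x: "0 \<le> x"
    and Kw: "\<And>t. t \<in> {0..x} \<Longrightarrow> norm (w t) \<le> K" and Kv: "\<And>t. t \<in> {0..x} \<Longrightarrow> norm (v t) \<le> K"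
  shows "cmod (transfer W U x z $ i $ j) \<le> real CARD('a + 'b) * exp (2 * (K + \<bar>Im z\<bar>) * x)"
proof -
  have "cmod (transfer W U x z $ i $ j) \<le>
      (\<Sum>k\<in>(UNIV::('a+'b) set). exp ((K + \<bar>Im z\<bar>) * x) * exp ((K + \<bar>Im z\<bar>) * x))"
    unfolding transfer_def vec_lambda_beta
    using entire_fundamental_entry_bound[OF W x Kw, of z]
      entire_fundamental_entry_bound[OF U x Kv, of "cnj z"]
    by (intro sum_norm_le) (auto simp: norm_mult intro!: mult_mono)
  then show ?thesis by (simp add: algebra_simps flip: exp_add)
qed

text \<open>M' = A_w M - M A_v. The factor W supplies the left product; the symmetry of the
  coefficient turns the adjoint equation of U at \<open>cnj z\<close> into the right product at
  z.\<close>

lemma transfer_derivative: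
  assumes W: "entire_fundamental w W" and U: "entire_fundamental v U" and x: "0 \<le> x"
  shows "((\<lambda>x. transfer W U x z $ i $ j) has_vector_derivative
     (\<Sum>l\<in>UNIV. dirac_coeff w z x $ i $ l * transfer W U x z $ l $ j) -
     (\<Sum>l\<in>UNIV. transfer W U x z $ i $ l * dirac_coeff v z x $ l $ j)) (at x within {0..})"
proof -
  let ?a = "dirac_coeff w z x" and ?b = "dirac_coeff v (cnj z) x"
  let ?W = "W z x" and ?U = "U (cnj z) x"
  \<comment> \<open>Entrywise form of A(conj z)^* J = - J A(z).\<close>
  have skew: "dirac_sign j * cnj (?b $ j $ l) = - (dirac_coeff v z x $ l $ j * dirac_sign l)" for j l
    by (cases j; cases l) (auto simp: dirac_coeff_entry)
  have "((\<lambda>x. \<Sum>k\<in>UNIV. W z x $ i $ k * (dirac_sign k * dirac_sign j * cnj (U (cnj z) x $ j $ k))) has_vector_derivative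
     (\<Sum>k\<in>UNIV. ?W $ i $ k * (dirac_sign k * dirac_sign j * cnj (\<Sum>l\<in>UNIV. ?b $ j $ l * ?U $ l $ k)) +
        (\<Sum>l\<in>UNIV. ?a $ i $ l * ?W $ l $ k) * (dirac_sign k * dirac_sign j * cnj (?U $ j $ k)))) (at x within {0..})"
    by (intro has_vector_derivative_sum has_vector_derivative_mult has_vector_derivative_mult_right
        bounded_linear.has_vector_derivative[OF bounded_linear_cnj]
        entire_fundamental_entry_derivative W U x)
  moreover have "(\<Sum>k\<in>UNIV. ?W $ i $ k * (dirac_sign k * dirac_sign j * cnj (\<Sum>l\<in>UNIV. ?b $ j $ l * ?U $ l $ k)))
      = - (\<Sum>l\<in>UNIV. transfer W U x z $ i $ l * dirac_coeff v z x $ l $ j)"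
  proof -
    have "(\<Sum>k\<in>UNIV. ?W $ i $ k * (dirac_sign k * dirac_sign j * cnj (\<Sum>l\<in>UNIV. ?b $ j $ l * ?U $ l $ k))) =
      (\<Sum>k\<in>UNIV. \<Sum>l\<in>UNIV. ?W $ i $ k * dirac_sign k * (dirac_sign j * cnj (?b $ j $ l)) * cnj (?U $ l $ k))"
      by (simp add: sum_distrib_left mult_ac)
    also have "\<dots> = (\<Sum>l\<in>UNIV. \<Sum>k\<in>UNIV. ?W $ i $ k * dirac_sign k * (dirac_sign j * cnj (?b $ j $ l)) * cnj (?U $ l $ k))"
      by (rule sum.swap)
    also have "\<dots> = - (\<Sum>l\<in>UNIV. transfer W U x z $ i $ l * dirac_coeff v z x $ l $ j)"
      unfolding skew by (simp add: transfer_def sum_distrib_left sum_distrib_right sum_negf mult_ac)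
    finally show ?thesis .
  qed
  moreover have "(\<Sum>k\<in>UNIV. (\<Sum>l\<in>UNIV. ?a $ i $ l * ?W $ l $ k) * (dirac_sign k * dirac_sign j * cnj (?U $ j $ k)))
      = (\<Sum>l\<in>UNIV. ?a $ i $ l * transfer W U x z $ l $ j)"
  proof -
    have "(\<Sum>k\<in>UNIV. (\<Sum>l\<in>UNIV. ?a $ i $ l * ?W $ l $ k) * (dirac_sign k * dirac_sign j * cnj (?U $ j $ k))) =
      (\<Sum>k\<in>UNIV. \<Sum>l\<in>UNIV. ?a $ i $ l * (?W $ l $ k * (dirac_sign k * dirac_sign j * cnj (?U $ j $ k))))"
      by (simp only: sum_distrib_right mult.assoc)
    also have "\<dots> = (\<Sum>l\<in>UNIV. \<Sum>k\<in>UNIV. ?a $ i $ l * (?W $ l $ k * (dirac_sign k * dirac_sign j * cnj (?U $ j $ k))))"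
      by (rule sum.swap)
    also have "\<dots> = (\<Sum>l\<in>UNIV. ?a $ i $ l * transfer W U x z $ l $ j)"
      by (simp add: transfer_def sum_distrib_left)
    finally show ?thesis .
  qed
  ultimately show ?thesis
    by (simp add: transfer_def sum.distrib)
qed

text \<open>Every term pairs a growth factor P with a decay factor M, whose product is independent
  of z, except the mismatch of the two Weyl planes, where P occurs twice and costs exp(2 x Im
  z).\<close>

lemma transfer_weyl_bound:
  fixes v w :: "real \<Rightarrow> complex^'b::finite^'a::finite"
  assumes v: "continuous_on {0..} v" and w: "continuous_on {0..} w"
    and \<phi>: "weyl_function v \<phi>" and \<psi>: "weyl_function w \<psi>"
    and W: "entire_fundamental w W" and U: "entire_fundamental v U" and x: "0 \<le> x" and z: "Im z > 0"
    and Kw: "\<And>t. t \<in> {0..x} \<Longrightarrow> norm (w t) \<le> K" and Kv: "\<And>t. t \<in> {0..x} \<Longrightarrow> norm (v t) \<le> K"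
  shows "cmod (transfer W U x z $ i $ j) \<le> real CARD('a + 'b) * exp (2 * K * x) *
    (4 + norm (\<phi> z - \<psi> z) * exp (2 * Im z * x))"
proof -
  define N where "N = real CARD('a + 'b)"
  define P where "P = exp ((K + Im z) * x)"
  define M where "M = exp ((K - Im z) * x)"
  define E where "E = exp (2 * K * x)"
  have PM: "P * M = E" "P * P = E * exp (2 * Im z * x)"
    by (simp_all add: P_def M_def E_def algebra_simps flip: exp_add)
  have pos: "P > 0" "M > 0" "E > 0" "N > 0" by (simp_all add: P_def M_def E_def N_def add_pos_pos)
  \<comment> \<open>Column j of U(x,z)^{-1}.\<close>
  define q :: "complex^('a + 'b)" where "q = (\<chi> k. dirac_sign k * dirac_sign j * cnj (U (cnj z) x $ j $ k))"
  have "transfer W U x z $ i $ j = (W z x *v q) $ i"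
    by (simp add: transfer_def q_def matrix_vector_mult_def)
  then have T: "cmod (transfer W U x z $ i $ j) \<le> norm (W z x *v q)"
    by (simp add: Finite_Cartesian_Product.norm_nth_le)
  have growW: "norm (W z x *v k) \<le> norm k * P" for k
    using entire_fundamental_growth[OF W x Kw, of z k] z by (simp add: P_def)
  have q: "norm q \<le> N * P"
  proof -
    have "norm q \<le> (\<Sum>k\<in>UNIV. cmod (q $ k))" by (simp add: norm_vec_def L2_set_le_sum)
    also have "\<dots> \<le> (\<Sum>k\<in>(UNIV::('a + 'b) set). P)"
      using entire_fundamental_entry_bound[OF U x Kv, of "cnj z"] z
      by (intro sum_mono) (simp add: q_def norm_mult P_def)
    finally show ?thesis by (simp add: N_def)
  qed
  \<comment> \<open>Deviation of q from the Weyl plane of v: q = (q1, \<phi> q1) + (0, r).\<close>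
  define r where "r = lower_part q - \<phi> z *v upper_part q"
  have r: "norm r \<le> N * (2 * M)"
  proof -
    have "cmod (r $ b) \<le> 2 * M" for b
    proof -
      define k :: "complex^'b" where "k = axis b 1"
      \<comment> \<open>The initial value is J-orthogonal to the Weyl plane of v. Entry b of r will
        be, up to sign, the conjugate of component j of g at x.\<close>
      define g where "g = (\<lambda>x. U (cnj z) x *v vjoin (adjoint_mat (\<phi> z) *v k) k)"
      have g: "dirac_solution v (cnj z) g" "g 0 = vjoin (adjoint_mat (\<phi> z) *v k) k"
        using U by (auto simp: g_def entire_fundamental_0[OF U] intro: entire_fundamental_solution)
      note dom = adjoint_weyl_solution_upper_le_lower[OF v \<phi> z g]
      have "norm (lower_part (g x)) \<le> norm (lower_part (g 0)) * exp ((K + Im (cnj z)) * x)"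
        by (rule dirac_solution_lower_bound[OF g(1) x Kv]) (use dom in auto)
      then have "norm (lower_part (g x)) \<le> M" by (simp add: g(2) k_def norm_axis_one M_def)
      then have "norm (g x) \<le> 2 * M"
        using norm_le_upper_lower[of "g x"] dom[OF x] by linarith
      moreover have "r $ b = - dirac_sign j * cnj (g x $ j)"
      proof -
        have "adjoint_mat (\<phi> z) *v k = (\<chi> a. cnj (\<phi> z $ b $ a))"
          by (simp add: k_def vec_eq_iff matrix_vector_mult_axis_nth adjoint_mat_def)
        then have "g x $ j = (\<Sum>a\<in>UNIV. U (cnj z) x $ j $ Inl a * cnj (\<phi> z $ b $ a)) + U (cnj z) x $ j $ Inr b"
          by (simp add: g_def matrix_vector_mult_def sum_UNIV_Plus vjoin_def k_def axis_def
              if_distrib[of "\<lambda>x. _ * x"] cong: if_cong)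
        then show ?thesis
          by (simp add: r_def q_def upper_part_def lower_part_def matrix_vector_mult_def sum_distrib_left sum_negf algebra_simps)
      qed
      then have "cmod (r $ b) \<le> norm (g x)" by (simp add: norm_mult Finite_Cartesian_Product.norm_nth_le)
      ultimately show ?thesis by simp
    qed
    then have "(\<Sum>b\<in>UNIV. cmod (r $ b)) \<le> (\<Sum>b\<in>(UNIV::'b set). 2 * M)"
      by (intro sum_mono)
    then have "norm r \<le> (\<Sum>b\<in>(UNIV::'b set). 2 * M)"
      unfolding norm_vec_def by (rule order_trans[OF L2_set_le_sum, rotated]) simp
    also have "\<dots> = real CARD('b) * (2 * M)" by simp
    also have "\<dots> \<le> N * (2 * M)"
      using pos by (intro mult_right_mono) (auto simp: N_def card_Plus simp flip: UNIV_Plus_UNIV)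
    finally show ?thesis .
  qed
  \<comment> \<open>The upper part of q is completed by \<psi> rather than \<phi>, so that f is a
    Weyl solution of the system of w and decays.\<close>
  define f where "f = (\<lambda>x. W z x *v vjoin (upper_part q) (\<psi> z *v upper_part q))"
  have f: "dirac_solution w z f" "f 0 = vjoin (upper_part q) (\<psi> z *v upper_part q)"
    using W by (auto simp: f_def entire_fundamental_0[OF W] intro: entire_fundamental_solution)
  have fx: "norm (f x) \<le> 2 * (N * E)"
  proof -
    note dom = weyl_solution_lower_le_upper[OF w \<psi> z f]
    have "norm (upper_part (f x)) \<le> norm (upper_part (f 0)) * exp ((K - Im z) * x)"
      by (rule dirac_solution_upper_bound[OF f(1) x Kw]) (use dom in auto)
    then have "norm (upper_part (f x)) \<le> norm (upper_part q) * M" by (simp add: f(2) M_def)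
    also have "\<dots> \<le> (N * P) * M"
      using pos q norm_upper_le[of q] by (intro mult_right_mono) auto
    finally show ?thesis
      using norm_le_upper_lower[of "f x"] dom[OF x] PM by (simp add: mult.assoc)
  qed
  have "q = vjoin (upper_part q) (\<psi> z *v upper_part q) + (vjoin 0 ((\<phi> z - \<psi> z) *v upper_part q) + vjoin 0 r)"
    by (simp add: r_def matrix_vector_mult_diff_rdistrib flip: vjoin_add)
  then have "W z x *v q = f x + (W z x *v vjoin 0 ((\<phi> z - \<psi> z) *v upper_part q) + W z x *v vjoin 0 r)"
    by (metis f_def matrix_vector_right_distrib)
  also have "norm \<dots> \<le> 2 * (N * E) + (norm (\<phi> z - \<psi> z) * (N * P) * P + N * (2 * M) * P)"
  proof (intro norm_triangle_mono fx)
    have "norm ((\<phi> z - \<psi> z) *v upper_part q) \<le> norm (\<phi> z - \<psi> z) * (N * P)"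
      using q norm_upper_le[of q]
      by (intro order_trans[OF norm_matrix_vector_mult_le] mult_left_mono) auto
    then show "norm (W z x *v vjoin 0 ((\<phi> z - \<psi> z) *v upper_part q)) \<le> norm (\<phi> z - \<psi> z) * (N * P) * P"
      using pos by (intro order_trans[OF growW]) simp
    show "norm (W z x *v vjoin 0 r) \<le> N * (2 * M) * P"
      using pos r by (intro order_trans[OF growW]) simp
  qed
  \<comment> \<open>The 4 is 2 from f plus 2 from r; each 2 bounds a full norm by twice its dominant
    half.\<close>
  also have "\<dots> = 2 * (N * E) + norm (\<phi> z - \<psi> z) * N * (P * P) + 2 * N * (P * M)"
    by (simp add: algebra_simps)
  also have "\<dots> = N * E * (4 + norm (\<phi> z - \<psi> z) * exp (2 * Im z * x))"
    unfolding PM by (simp add: algebra_simps)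
  finally show ?thesis using T by (simp add: N_def E_def)
qed

section \<open>Boundedness and constancy of the transfer matrix\<close>

lemma upper_ray_polar:
  obtains \<theta> where "0 < \<theta>" "\<theta> < pi" "\<And>t. t > 0 \<Longrightarrow> of_real t * cis \<theta> \<in> upper_ray c"
proof
  \<comment> \<open>The ray consists of the positive multiples of c + i.\<close>
  define \<zeta> where "\<zeta> = Complex c 1"
  have ne: "\<zeta> \<noteq> 0" "cmod \<zeta> > 0" by (auto simp: \<zeta>_def complex_eq_iff)
  show "0 < Arg \<zeta>" "Arg \<zeta> < pi"
    using Arg_lt_pi[of \<zeta>] by (auto simp: \<zeta>_def)
  fix t :: real assume "t > 0"
  have "cis (Arg \<zeta>) = of_real (1 / cmod \<zeta>) * \<zeta>"
    using cis_Arg[OF ne(1)] by (simp add: sgn_eq)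
  then have "of_real t * cis (Arg \<zeta>) = of_real (t / cmod \<zeta>) * \<zeta>" by simp
  moreover have "t / cmod \<zeta> > 0" using \<open>t > 0\<close> ne by simp
  ultimately show "of_real t * cis (Arg \<zeta>) \<in> upper_ray c"
    by (simp only:) (simp add: upper_ray_def \<zeta>_def)
qed

lemma transfer_bounded_upper:
  fixes v w :: "real \<Rightarrow> complex^'b::finite^'a::finite"
  assumes v: "continuous_on {0..} v" and w: "continuous_on {0..} w"
    and \<phi>: "weyl_function v \<phi>" and \<psi>: "weyl_function w \<psi>"
    and W: "entire_fundamental w W" and U: "entire_fundamental v U" and x: "0 \<le> x"
    and ray: "\<And>z. z \<in> upper_ray c \<Longrightarrow> cmod z \<ge> R \<Longrightarrow> norm (\<phi> z - \<psi> z) \<le> C * exp (- 2 * Im z * x)"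
  shows "\<exists>M. \<forall>z. Im z \<ge> 0 \<longrightarrow> cmod (transfer W U x z $ i $ j) \<le> M"
proof -
  obtain Kv where Kv: "\<And>t. t \<in> {0..x} \<Longrightarrow> norm (v t) \<le> Kv"
    using halfline_bounded_on_interval[OF v] by blast
  obtain Kw where Kw: "\<And>t. t \<in> {0..x} \<Longrightarrow> norm (w t) \<le> Kw"
    using halfline_bounded_on_interval[OF w] by blast
  define K where "K = max Kv Kw"
  have K: "norm (v t) \<le> K" "norm (w t) \<le> K" if "t \<in> {0..x}" for t
    using Kv Kw that by (force simp: K_def)+
  define N where "N = real CARD('a + 'b)"
  have N: "N \<ge> 0" by (simp add: N_def)
  let ?T = "\<lambda>z. transfer W U x z $ i $ j"
  have hol: "?T holomorphic_on UNIV" by (rule transfer_holomorphic[OF W U x])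
  have grow: "cmod (?T z) \<le> N * exp (2 * (K + \<bar>Im z\<bar>) * x)" for z
    unfolding N_def by (rule transfer_growth[OF W U x K(2,1)])
  have "bounded (?T ` cball 0 R)"
    by (intro compact_imp_bounded compact_continuous_image holomorphic_on_imp_continuous_on
        holomorphic_on_subset[OF hol]) auto
  then obtain B where B: "\<And>z. cmod z \<le> R \<Longrightarrow> cmod (?T z) \<le> B"
    by (fastforce simp: bounded_iff)
  \<comment> \<open>B covers the part of the ray inside the disc of radius R, where the hypothesis
    is silent; beyond it the Weyl bound applies.\<close>
  define M where "M = max B (N * exp (2 * K * x) * (4 + C))"
  obtain \<theta> where \<theta>: "0 < \<theta>" "\<theta> < pi" "\<And>t. t > 0 \<Longrightarrow> of_real t * cis \<theta> \<in> upper_ray c"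
    using upper_ray_polar by metis
  show ?thesis
  proof (rule bounded_upper_half_plane[OF hol _ _ _ \<theta>(1,2)])
    \<comment> \<open>The exponent constant 2 x + 1, instead of 2 x, remains positive at x =
      0.\<close>
    show "cmod (?T z) \<le> (N * exp (2 * K * x)) * exp ((2 * x + 1) * cmod z)" for z
    proof -
      have "2 * (K + \<bar>Im z\<bar>) * x \<le> 2 * K * x + (2 * x + 1) * cmod z"
        using mult_right_mono[OF abs_Im_le_cmod x, of z] by (simp add: algebra_simps) (use norm_ge_zero[of z] in linarith)
      then have "exp (2 * (K + \<bar>Im z\<bar>) * x) \<le> exp (2 * K * x) * exp ((2 * x + 1) * cmod z)"
        by (simp flip: exp_add)
      then have "N * exp (2 * (K + \<bar>Im z\<bar>) * x) \<le> N * (exp (2 * K * x) * exp ((2 * x + 1) * cmod z))"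
        using N by (rule mult_left_mono)
      then show ?thesis using grow[of z] by (simp add: mult.assoc)
    qed
    show "cmod (?T (of_real t)) \<le> N * exp (2 * K * x)" for t
      using grow[of "of_real t"] by simp
    show "cmod (?T (of_real t * cis \<theta>)) \<le> M" if t: "t \<ge> 1" for t
    proof (cases "t \<le> R")
      case True
      then have "cmod (?T (of_real t * cis \<theta>)) \<le> B" using t by (intro B) (simp add: norm_mult)
      then show ?thesis by (simp add: M_def)
    next
      case False
      define z where "z = of_real t * cis \<theta>"
      have z: "z \<in> upper_ray c" "cmod z = t" "Im z > 0"
        using \<theta>(3)[of t] t by (auto simp: z_def norm_mult upper_ray_def)
      have "norm (\<phi> z - \<psi> z) * exp (2 * Im z * x) \<le> (C * exp (- 2 * Im z * x)) * exp (2 * Im z * x)"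
        using ray[OF z(1)] z False by (intro mult_right_mono) auto
      also have "\<dots> = C" by (simp add: mult.assoc flip: exp_add)
      finally have "N * exp (2 * K * x) * (4 + norm (\<phi> z - \<psi> z) * exp (2 * Im z * x))
          \<le> N * exp (2 * K * x) * (4 + C)"
        using N by (intro mult_left_mono) auto
      moreover have "cmod (?T z) \<le> N * exp (2 * K * x) * (4 + norm (\<phi> z - \<psi> z) * exp (2 * Im z * x))"
        unfolding N_def by (rule transfer_weyl_bound[OF v w \<phi> \<psi> W U x z(3) K(2,1)])
      ultimately show ?thesis by (simp add: M_def z_def)
    qed
    show "0 < 2 * x + 1" using x by simp
  qed
qed

lemma transfer_constant:
  fixes v w :: "real \<Rightarrow> complex^'b::finite^'a::finite"
  assumes v: "continuous_on {0..} v" and w: "continuous_on {0..} w"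
    and \<phi>: "weyl_function v \<phi>" and \<psi>: "weyl_function w \<psi>"
    and W: "entire_fundamental w W" and U: "entire_fundamental v U" and x: "0 \<le> x"
    and ray: "\<And>z. z \<in> upper_ray c \<Longrightarrow> cmod z \<ge> R \<Longrightarrow> norm (\<phi> z - \<psi> z) \<le> C * exp (- 2 * Im z * x)"
  shows "transfer W U x z = transfer W U x 0"
proof -
  have ray': "norm (\<psi> z - \<phi> z) \<le> C * exp (- 2 * Im z * x)" if "z \<in> upper_ray c" "cmod z \<ge> R" for z
    using ray[OF that] by (simp add: norm_minus_commute)
  have "transfer W U x z $ i $ j = transfer W U x 0 $ i $ j" for i j
  proof -
    let ?T = "\<lambda>z. transfer W U x z $ i $ j"
    obtain M where M: "\<And>z. Im z \<ge> 0 \<Longrightarrow> cmod (?T z) \<le> M"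
      using transfer_bounded_upper[OF v w \<phi> \<psi> W U x ray, where i = i and j = j] by blast
    obtain M' where M': "\<And>z. Im z \<ge> 0 \<Longrightarrow> cmod (transfer U W x z $ j $ i) \<le> M'"
      using transfer_bounded_upper[OF w v \<psi> \<phi> U W x ray', where i = j and j = i] by blast
    have "cmod (?T z) \<le> max M M'" for z
    proof (cases "Im z \<ge> 0")
      case True
      then show ?thesis using M by (simp add: le_max_iff_disj)
    next
      case False
      then have "cmod (transfer U W x (cnj z) $ j $ i) \<le> M'" by (intro M') simp
      then show ?thesis by (subst transfer_swap) (simp add: norm_mult le_max_iff_disj)
    qed
    then have "bounded (range ?T)" by (auto simp: bounded_iff)
    with transfer_holomorphic[OF W U x] have "?T constant_on UNIV" by (rule Liouville_theorem)
    then show ?thesis by (auto simp: constant_on_def)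
  qed
  then show ?thesis by (simp add: vec_eq_iff)
qed

section \<open>Recovery of the potential\<close>

lemma C1_on_halfline_imp_continuous_on:
  assumes "C1_on_halfline v" shows "continuous_on {0..} v"
  using assms unfolding C1_on_halfline_def
  by (meson atLeast_iff continuous_on_eq_continuous_within has_vector_derivative_continuous)

lemma potentials_eq_if_transfer_constant:
  fixes v w :: "real \<Rightarrow> complex^'b::finite^'a::finite"
  assumes W: "entire_fundamental w W" and U: "entire_fundamental v U"
    and const: "\<And>x z. 0 \<le> x \<Longrightarrow> x < T \<Longrightarrow> transfer W U x z = transfer W U x 0"
    and x: "0 \<le> x" "x < T"
  shows "v x = w x"
proof -
  define m where "m x = transfer W U x 0" for x
  define S where "S = {0..<T}"
  \<comment> \<open>m does not depend on z, yet it satisfies the transfer equation for every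
    z.\<close>
  have within: "((\<lambda>x. m x $ i $ j) has_vector_derivative
     (\<Sum>l\<in>UNIV. dirac_coeff w z x $ i $ l * m x $ l $ j) -
     (\<Sum>l\<in>UNIV. m x $ i $ l * dirac_coeff v z x $ l $ j)) (at x within S)" if "x \<in> S" for x z i j
  proof -
    from that have x: "0 \<le> x" "x < T" by (auto simp: S_def)
    have "((\<lambda>x. transfer W U x z $ i $ j) has_vector_derivative
       (\<Sum>l\<in>UNIV. dirac_coeff w z x $ i $ l * m x $ l $ j) -
       (\<Sum>l\<in>UNIV. m x $ i $ l * dirac_coeff v z x $ l $ j)) (at x within S)"
      using transfer_derivative[OF W U x(1), of z i j] unfolding const[OF x, of z] m_def
      by (rule has_vector_derivative_within_subset) (auto simp: S_def)
    then show ?thesis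
    proof (rule has_vector_derivative_transform[rotated 2])
      show "m y $ i $ j = transfer W U y z $ i $ j" if "y \<in> S" for y
        using const[of y z] that by (simp add: m_def S_def)
    qed fact
  qed
  \<comment> \<open>S has no isolated point, so derivatives within S are unique, also at the
    endpoint 0.\<close>
  have nontriv: "at x within S \<noteq> bot" if "x \<in> S" for x
  proof -
    have "S \<noteq> {y}" for y
    proof
      assume "S = {y}"
      moreover have "(x + T) / 2 \<in> S" using that by (auto simp: S_def)
      ultimately show False using that by (auto simp: S_def)
    qed
    moreover have "connected S" by (simp add: S_def)
    ultimately show ?thesis
      unfolding trivial_limit_within using connected_imp_perfect[OF _ that] by blast
  qed
  \<comment> \<open>Equating the derivatives for z = 0 and z = 1 leaves J m = m J, hence m is block
    diagonal.\<close>
  have off: "m x $ i $ j = 0" if "x \<in> S" "dirac_sign i \<noteq> dirac_sign j" for x i j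
  proof -
    have "(\<Sum>l\<in>UNIV. dirac_coeff w 0 x $ i $ l * m x $ l $ j) - (\<Sum>l\<in>UNIV. m x $ i $ l * dirac_coeff v 0 x $ l $ j)
        = (\<Sum>l\<in>UNIV. dirac_coeff w 1 x $ i $ l * m x $ l $ j) - (\<Sum>l\<in>UNIV. m x $ i $ l * dirac_coeff v 1 x $ l $ j)"
      by (rule vector_derivative_unique_within[OF nontriv within within]) (use that in auto)
    then show ?thesis using that(2)
      by (cases i; cases j) (auto simp: sum_UNIV_Plus dirac_coeff_entry if_distrib[of "\<lambda>x. x * _"]
          if_distrib[of "\<lambda>x. _ * x"] cong: if_cong)
  qed
  \<comment> \<open>At z = 0 the coefficients are block off-diagonal and m is block diagonal, so the
    diagonal blocks have derivative 0 and keep their value at x = 0.\<close>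
  have diag: "m x $ i $ j = (if i = j then 1 else 0)" if "x \<in> S" "dirac_sign i = dirac_sign j" for x i j
  proof -
    have "((\<lambda>x. m x $ i $ j) has_vector_derivative 0) (at t within S)" if t: "t \<in> S" for t
    proof -
      have zero_w: "dirac_coeff w 0 t $ i $ l * m t $ l $ j = 0" for l
        using off[OF t, of l j] \<open>dirac_sign i = dirac_sign j\<close> by (cases i; cases l; cases j) (auto simp: dirac_coeff_entry)
      have zero_v: "m t $ i $ l * dirac_coeff v 0 t $ l $ j = 0" for l
        using off[OF t, of i l] \<open>dirac_sign i = dirac_sign j\<close> by (cases i; cases l; cases j) (auto simp: dirac_coeff_entry)
      show ?thesis using within[OF t, of i j 0] unfolding zero_w zero_v by simp
    qed
    then obtain c where c: "\<And>t. t \<in> S \<Longrightarrow> m t $ i $ j = c"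
      by (rule has_vector_derivative_zero_constant[of S "\<lambda>t. m t $ i $ j", rotated]) (auto simp: S_def)
    have "0 \<in> S" using that by (auto simp: S_def)
    then have "m x $ i $ j = m 0 $ i $ j" using c that by simp
    then show ?thesis by (simp add: m_def transfer_0[OF W U] mat_def)
  qed
  have m: "m t = mat 1" if "t \<in> S" for t
  proof -
    have "m t $ i $ j = (if i = j then 1 else 0)" for i j
      by (cases "dirac_sign i = dirac_sign j") (use off[OF that] diag[OF that] in auto)
    then show ?thesis by (simp add: vec_eq_iff mat_def)
  qed
  have "x \<in> S" using x by (simp add: S_def)
  have "v x $ a $ b = w x $ a $ b" for a b
  proof -
    \<comment> \<open>With m = 1 on S, the equation for this entry at z = 0 reads 0 = i (w - v) in
      position (a, b).\<close>
    have "((\<lambda>x. m x $ Inl a $ Inr b) has_vector_derivative 0) (at x within S)"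
      by (rule has_vector_derivative_transform[OF \<open>x \<in> S\<close> _ has_vector_derivative_const[of 0]])
         (simp add: m mat_def)
    from vector_derivative_unique_within[OF nontriv[OF \<open>x \<in> S\<close>] this within[OF \<open>x \<in> S\<close>, of _ _ 0]]
    show ?thesis
      by (simp add: m[OF \<open>x \<in> S\<close>] mat_def sum_UNIV_Plus dirac_coeff_entry if_distrib[of "\<lambda>x. x * _"]
          if_distrib[of "\<lambda>x. _ * x"] cong: if_cong)
  qed
  then show ?thesis by (simp add: vec_eq_iff)
qed

theorem theorem6p5:
  fixes v w :: "real \<Rightarrow> complex^'b::finite^'a::finite"
    and \<phi> \<psi> :: "complex \<Rightarrow> complex^'a^'b"
    and T :: real
  assumes "T > 0"
    and "C1_on_halfline v" and "C1_on_halfline w"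
    and "weyl_function v \<phi>" and "weyl_function w \<psi>"
    and "\<exists>c::real. \<forall>\<epsilon>>0. (\<lambda>z. norm (\<phi> z - \<psi> z))
           \<in> O[inf at_infinity (principal (upper_ray c))](\<lambda>z. cmod (exp (2 * \<i> * complex_of_real (T - \<epsilon>) * z)))"
  shows "\<forall>x\<in>{0..T}. v x = w x"
proof -
  have v: "continuous_on {0..} v" and w: "continuous_on {0..} w"
    using assms(2,3) by (auto intro: C1_on_halfline_imp_continuous_on)
  obtain U where U: "entire_fundamental v U"
    using dirac_entire_fundamental_solution[OF v] by blast
  obtain W where W: "entire_fundamental w W"
    using dirac_entire_fundamental_solution[OF w] by blast
  obtain c where c: "\<And>\<epsilon>. \<epsilon> > 0 \<Longrightarrow> (\<lambda>z. norm (\<phi> z - \<psi> z))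
      \<in> O[inf at_infinity (principal (upper_ray c))](\<lambda>z. cmod (exp (2 * \<i> * complex_of_real (T - \<epsilon>) * z)))"
    using assms(6) by blast
  have const: "transfer W U x z = transfer W U x 0" if "0 \<le> x" "x < T" for x z
  proof -
    have "(\<lambda>z. norm (\<phi> z - \<psi> z)) \<in> O[inf at_infinity (principal (upper_ray c))](\<lambda>z. cmod (exp (2 * \<i> * complex_of_real x * z)))"
      \<comment> \<open>\<epsilon> = T - x makes the decay rate exactly the one that cancels exp(2 x
        Im z).\<close>
      using c[of "T - x"] that by simp
    then obtain C where "\<forall>\<^sub>F z in inf at_infinity (principal (upper_ray c)).
        norm (\<phi> z - \<psi> z) \<le> C * cmod (exp (2 * \<i> * complex_of_real x * z))"
      by (elim landau_o.bigE) auto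
    then obtain R where "\<And>z. R \<le> cmod z \<Longrightarrow> z \<in> upper_ray c \<Longrightarrow>
        norm (\<phi> z - \<psi> z) \<le> C * cmod (exp (2 * \<i> * complex_of_real x * z))"
      by (auto simp: eventually_inf_principal eventually_at_infinity)
    moreover have "cmod (exp (2 * \<i> * complex_of_real x * z)) = exp (- 2 * Im z * x)" for z
      by (simp add: mult_ac)
    ultimately have "\<And>z. z \<in> upper_ray c \<Longrightarrow> cmod z \<ge> R \<Longrightarrow> norm (\<phi> z - \<psi> z) \<le> C * exp (- 2 * Im z * x)"
      by metis
    then show ?thesis by (rule transfer_constant[OF v w assms(4,5) W U that(1)])
  qed
  have eq: "v x = w x" if "0 \<le> x" "x < T" for x
    by (rule potentials_eq_if_transfer_constant[OF W U const that])
  \<comment> \<open>The estimates reach only x < T; continuity from the left gives the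
    endpoint.\<close>
  have "v T = w T"
  proof -
    have lim: "(f \<longlongrightarrow> f T) (at T within {0..<T})" if "continuous_on {0..} f"
      for f :: "real \<Rightarrow> complex^'b^'a"
    proof (rule tendsto_within_subset)
      show "(f \<longlongrightarrow> f T) (at T within {0..})"
        using that \<open>T > 0\<close> by (auto simp: continuous_on_def)
    qed auto
    have "(v \<longlongrightarrow> w T) (at T within {0..<T})"
      by (rule Lim_transform_within[OF lim[OF w] zero_less_one]) (simp add: eq)
    moreover have "at T within {0..<T} \<noteq> bot"
      using \<open>T > 0\<close> by (simp add: at_within_eq_bot_iff)
    ultimately show ?thesis using lim[OF v] tendsto_unique by blast
  qed
  then show ?thesis using eq by (metis atLeastAtMost_iff less_eq_real_def)
qed

end
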